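(* Let $E$ be a holomorphic vector bundle over a compact Hermitian manifold $(M,\omega_g)$, and let $h$ and $h_0$ be smooth Hermitian metrics on $E$. If the Hermitian-Yang-Mills tensors of their Chern connections satisfy $\Lambda_{\omega_g}\left(\sqrt{-1}R^{h_0}\right)>0$ and $$\Lambda_{\omega_g}\left(\sqrt{-1}R^{h}\right)\le\Lambda_{\omega_g}\left(\sqrt{-1}R^{h_0}\right)$$ as Hermitian tensors in $\Gamma(M,E^*\otimes\overline E^* )$, then $h\le h_0$.
   Context: $M$ is a compact complex manifold, $g$ a smooth Hermitian metric on $M$ with fundamental form $\omega_g=\sqrt{-1}\,g_{i\bar j}dz^i\wedge d\bar z^j$ (not assumed closed), and $\Lambda_{\omega_g}(\sqrt{-1}\,a_{i\bar j}dz^i\wedge d\bar z^j)=g^{i\bar j}a_{i\bar j}$. For a smooth Hermitian metric $h$ on $E$, $R^h\in\Gamma(M,\Lambda^{1,1}T^*M\otimes E^*\otimes\overline E^* )$ is the curvature of the Chern connection of $(E,h)$ with the endomorphism index lowered by $h$: if $\Theta^h=(\nabla^h)^2$, then $R^h_{\alpha\bar\beta}=h_{\gamma\bar\beta}(\Theta^h)_\alpha^\gamma$. The Hermitian-Yang-Mills tensor is the Hermitian form $\Lambda_{\omega_g}(\sqrt{-1}R^h)=\left(g^{i\bar j}R^h_{i\bar j\alpha\bar\beta}\right)e^\alpha\otimes\bar e^\beta\in\Gamma(M,E^*\otimes\overline E^* )$. Inequalities $A\le B$, $A>0$ between Hermitian tensors in $\Gamma(M,E^*\otimes\overline E^* )$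 (including Hermitian metrics) are pointwise inequalities of Hermitian forms on the fibres $E_x$, $x\in M$. *)

theory Defs
  imports "HOL-Analysis.Analysis"
begin

section \<open>Calculus on open subsets of complex coordinate space\<close>

primrec C_k_on :: "nat \<Rightarrow> ('a::real_normed_vector \<Rightarrow> 'b::real_normed_vector) \<Rightarrow> 'a set \<Rightarrow> bool" where
  "C_k_on 0 f S \<longleftrightarrow> continuous_on S f"
| "C_k_on (Suc k) f S \<longleftrightarrow> (\<forall>z\<in>S. f differentiable at z) \<and>
     (\<forall>v. C_k_on k (\<lambda>z. frechet_derivative f (at z) v) S)"

text \<open>Smoothness in the real sense; only used on open sets \<open>S\<close>.\<close>

definition smooth_on :: "('a::real_normed_vector \<Rightarrow> 'b::real_normed_vector) \<Rightarrow> 'a set \<Rightarrow> bool" where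
  "smooth_on f S \<longleftrightarrow> (\<forall>k. C_k_on k f S)"

text \<open>Holomorphic functions of several variables: complex (Frechet) differentiability at every
  point; only used on open sets \<open>S\<close>.\<close>

definition hol_on :: "(complex^('n::finite) \<Rightarrow> complex) \<Rightarrow> (complex^'n) set \<Rightarrow> bool" where
  "hol_on f S \<longleftrightarrow>
     (\<forall>z\<in>S. \<exists>L. (f has_derivative L) (at z) \<and> (\<forall>c v. L (c *s v) = c * L v))"

text \<open>The Wirtinger derivatives \<open>\<partial>/\<partial>z\<^sup>i\<close> and \<open>\<partial>/\<partial>(cnj z\<^sup>i)\<close>.\<close>

definition dz :: "'n::finite \<Rightarrow> (complex^'n \<Rightarrow> complex) \<Rightarrow> complex^'n \<Rightarrow> complex" where
  "dz i f z = (frechet_derivative f (at z) (axis i 1)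
               - \<i> * frechet_derivative f (at z) (axis i \<i>)) / 2"

definition dzbar :: "'n::finite \<Rightarrow> (complex^'n \<Rightarrow> complex) \<Rightarrow> complex^'n \<Rightarrow> complex" where
  "dzbar i f z = (frechet_derivative f (at z) (axis i 1)
               + \<i> * frechet_derivative f (at z) (axis i \<i>)) / 2"

text \<open>\<open>herm H s t = H\<^sub>\<alpha>\<^sub>\<beta> s\<^sup>\<alpha> (cnj t)\<^sup>\<beta>\<close>: sesquilinear, conjugate linear in the second argument.\<close>

definition herm :: "complex^('r::finite)^'r \<Rightarrow> complex^'r \<Rightarrow> complex^'r \<Rightarrow> complex" where
  "herm H s t = (\<Sum>\<alpha>\<in>UNIV. \<Sum>\<beta>\<in>UNIV. H $ \<alpha> $ \<beta> * s $ \<alpha> * cnj (t $ \<beta>))"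

definition hermitian_pos_def :: "complex^('r::finite)^'r \<Rightarrow> bool" where
  "hermitian_pos_def H \<longleftrightarrow> (\<forall>\<alpha> \<beta>. H $ \<beta> $ \<alpha> = cnj (H $ \<alpha> $ \<beta>)) \<and>
     (\<forall>s. s \<noteq> 0 \<longrightarrow> 0 < Re (herm H s s))"

section \<open>Compact complex manifolds and Hermitian metrics on them\<close>

text \<open>A chart is a pair of its domain and its coordinate map.  The manifold is the carrier of an
  abstract topology \<open>X\<close>.  Connectedness is not required.\<close>

type_synonym ('m, 'n) chart = "'m set \<times> ('m \<Rightarrow> complex^'n)"

definition is_chart :: "'m topology \<Rightarrow> ('m, 'n::finite) chart \<Rightarrow> bool" where
  "is_chart X c \<longleftrightarrow> openin X (fst c) \<and> open (snd c ` fst c) \<and>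
     homeomorphic_map (subtopology X (fst c)) (top_of_set (snd c ` fst c)) (snd c)"

definition chart_inv :: "('m, 'n::finite) chart \<Rightarrow> complex^'n \<Rightarrow> 'm" where
  "chart_inv c = the_inv_into (fst c) (snd c)"

definition transition :: "('m, 'n::finite) chart \<Rightarrow> ('m, 'n) chart \<Rightarrow> complex^'n \<Rightarrow> complex^'n" where
  "transition c c' = snd c' \<circ> chart_inv c"

text \<open>Second countability follows from compactness and the existence of charts.\<close>

definition compact_complex_manifold :: "'m topology \<Rightarrow> ('m, 'n::finite) chart set \<Rightarrow> bool" where
  "compact_complex_manifold X A \<longleftrightarrow>
     compact_space X \<and> Hausdorff_space X \<and> (\<forall>c\<in>A. is_chart X c) \<and>
     topspace X = (\<Union>c\<in>A. fst c) \<and>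
     (\<forall>c\<in>A. \<forall>c'\<in>A. \<forall>k. hol_on (\<lambda>z. transition c c' z $ k) (snd c ` (fst c \<inter> fst c')))"

text \<open>A Hermitian metric on the holomorphic tangent bundle is given by its coefficient matrices:
  \<open>g c x $ i $ j\<close> is the coefficient of \<open>dz\<^sup>i \<otimes> d(cnj z\<^sup>j)\<close> at \<open>x\<close> in the chart \<open>c\<close>.\<close>

definition hermitian_metric ::
  "('m, 'n::finite) chart set \<Rightarrow> (('m, 'n) chart \<Rightarrow> 'm \<Rightarrow> complex^'n^'n) \<Rightarrow> bool" where
  "hermitian_metric A g \<longleftrightarrow>
     (\<forall>c\<in>A. (\<forall>x\<in>fst c. hermitian_pos_def (g c x)) \<and>
        (\<forall>i j. smooth_on (\<lambda>z. g c (chart_inv c z) $ i $ j) (snd c ` fst c))) \<and>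
     (\<forall>c\<in>A. \<forall>c'\<in>A. \<forall>x\<in>fst c \<inter> fst c'. \<forall>i j.
        g c x $ i $ j =
          (\<Sum>k\<in>UNIV. \<Sum>l\<in>UNIV. g c' x $ k $ l
             * dz i (\<lambda>z. transition c c' z $ k) (snd c x)
             * cnj (dz j (\<lambda>z. transition c c' z $ l) (snd c x))))"

section \<open>Holomorphic vector bundles and Hermitian metrics on them\<close>

text \<open>A local trivialization is a pair \<open>(W, \<psi>)\<close> where \<open>e \<mapsto> (\<pi> e, \<psi> e)\<close> maps \<open>\<pi>\<^sup>-\<^sup>1(W)\<close>
  homeomorphically onto \<open>W \<times> \<complex>\<^sup>r\<close>.  The vector space structure of a fibre is the one transported
  from \<open>\<complex>\<^sup>r\<close> along \<open>\<psi>\<close>; it does not depend on \<open>\<psi>\<close> because transition maps are linear on fibres.\<close>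

type_synonym ('m, 'e, 'r) triv = "'m set \<times> ('e \<Rightarrow> complex^'r)"

definition is_triv :: "'m topology \<Rightarrow> 'e topology \<Rightarrow> ('e \<Rightarrow> 'm) \<Rightarrow> ('m, 'e, 'r::finite) triv \<Rightarrow> bool" where
  "is_triv X E \<pi> t \<longleftrightarrow> openin X (fst t) \<and>
     homeomorphic_map (subtopology E {e \<in> topspace E. \<pi> e \<in> fst t})
       (prod_topology (subtopology X (fst t)) (euclidean :: (complex^'r) topology))
       (\<lambda>e. (\<pi> e, snd t e))"

definition holomorphic_vector_bundle ::
  "'m topology \<Rightarrow> ('m, 'n::finite) chart set \<Rightarrow> 'e topology \<Rightarrow> ('e \<Rightarrow> 'm) \<Rightarrow> ('m, 'e, 'r::finite) triv set \<Rightarrow> bool"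
where
  "holomorphic_vector_bundle X A E \<pi> T \<longleftrightarrow>
     continuous_map E X \<pi> \<and> (\<forall>t\<in>T. is_triv X E \<pi> t) \<and> topspace X = (\<Union>t\<in>T. fst t) \<and>
     (\<forall>t\<in>T. \<forall>t'\<in>T. \<exists>a :: 'm \<Rightarrow> complex^'r^'r.
        (\<forall>e\<in>topspace E. \<pi> e \<in> fst t \<inter> fst t' \<longrightarrow> snd t' e = a (\<pi> e) *v snd t e) \<and>
        (\<forall>c\<in>A. \<forall>\<alpha> \<beta>. hol_on (\<lambda>z. a (chart_inv c z) $ \<alpha> $ \<beta>)
           (snd c ` (fst c \<inter> fst t \<inter> fst t'))))"

definition frame ::
  "'e topology \<Rightarrow> ('e \<Rightarrow> 'm) \<Rightarrow> ('m, 'e, 'r::finite) triv \<Rightarrow> 'm \<Rightarrow> 'r \<Rightarrow> 'e" where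
  "frame E \<pi> t x \<alpha> = (THE e. e \<in> topspace E \<and> \<pi> e = x \<and> snd t e = axis \<alpha> 1)"

text \<open>The matrix \<open>h(e\<^sub>\<alpha>, e\<^sub>\<beta>)\<close> in the holomorphic frame of a trivialization.\<close>

definition gram ::
  "'e topology \<Rightarrow> ('e \<Rightarrow> 'm) \<Rightarrow> ('m, 'e, 'r::finite) triv \<Rightarrow> ('e \<Rightarrow> 'e \<Rightarrow> complex) \<Rightarrow> 'm \<Rightarrow> complex^'r^'r" where
  "gram E \<pi> t h x = (\<chi> \<alpha> \<beta>. h (frame E \<pi> t x \<alpha>) (frame E \<pi> t x \<beta>))"

text \<open>Only the values of \<open>h\<close> on pairs of vectors in the same fibre are relevant.\<close>

definition bundle_metric ::
  "('m, 'n::finite) chart set \<Rightarrow> 'e topology \<Rightarrow> ('e \<Rightarrow> 'm) \<Rightarrow> ('m, 'e, 'r::finite) triv set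
    \<Rightarrow> ('e \<Rightarrow> 'e \<Rightarrow> complex) \<Rightarrow> bool" where
  "bundle_metric A E \<pi> T h \<longleftrightarrow>
     (\<forall>t\<in>T.
        (\<forall>v\<in>topspace E. \<forall>w\<in>topspace E. \<pi> v \<in> fst t \<and> \<pi> w = \<pi> v \<longrightarrow>
           h v w = herm (gram E \<pi> t h (\<pi> v)) (snd t v) (snd t w)) \<and>
        (\<forall>x\<in>fst t. hermitian_pos_def (gram E \<pi> t h x)) \<and>
        (\<forall>c\<in>A. \<forall>\<alpha> \<beta>. smooth_on (\<lambda>z. gram E \<pi> t h (chart_inv c z) $ \<alpha> $ \<beta>)
           (snd c ` (fst c \<inter> fst t))))"

section \<open>The Chern connection and its curvature\<close>

text \<open>Over an open set \<open>V\<close> of coordinate space, in a holomorphic frame, sections are functions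
  \<open>V \<rightarrow> \<complex>\<^sup>r\<close> and a connection is given by the coefficient matrices \<open>P i\<close>, \<open>Q i\<close> of \<open>dz\<^sup>i\<close>, \<open>d(cnj z\<^sup>i)\<close> in
  its connection form.\<close>

definition nabla ::
  "('n::finite \<Rightarrow> complex^'n \<Rightarrow> complex^('r::finite)^'r) \<Rightarrow> 'n \<Rightarrow> (complex^'n \<Rightarrow> complex^'r) \<Rightarrow> complex^'n \<Rightarrow> complex^'r"
where
  "nabla P i s z = (\<chi> \<gamma>. dz i (\<lambda>w. s w $ \<gamma>) z) + P i z *v s z"

definition nablabar ::
  "('n::finite \<Rightarrow> complex^'n \<Rightarrow> complex^('r::finite)^'r) \<Rightarrow> 'n \<Rightarrow> (complex^'n \<Rightarrow> complex^'r) \<Rightarrow> complex^'n \<Rightarrow> complex^'r"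
where
  "nablabar Q i s z = (\<chi> \<gamma>. dzbar i (\<lambda>w. s w $ \<gamma>) z) + Q i z *v s z"

text \<open>The Chern connection: its \<open>(0,1)\<close>-part is the Dolbeault operator and it is compatible with the
  metric, \<open>d (H(s,t)) = H(\<nabla>s,t) + H(s,\<nabla>t)\<close>, the latter split into types.\<close>

definition is_chern_connection ::
  "(complex^('n::finite)) set \<Rightarrow> (complex^'n \<Rightarrow> complex^('r::finite)^'r)
   \<Rightarrow> ('n \<Rightarrow> complex^'n \<Rightarrow> complex^'r^'r) \<Rightarrow> ('n \<Rightarrow> complex^'n \<Rightarrow> complex^'r^'r) \<Rightarrow> bool" where
  "is_chern_connection V H P Q \<longleftrightarrow>
     (\<forall>i \<alpha> \<beta>. smooth_on (\<lambda>z. P i z $ \<alpha> $ \<beta>) V \<and> smooth_on (\<lambda>z. Q i z $ \<alpha> $ \<beta>) V) \<and>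
     (\<forall>s i. smooth_on s V \<longrightarrow>
        (\<forall>z\<in>V. nablabar Q i s z = (\<chi> \<gamma>. dzbar i (\<lambda>w. s w $ \<gamma>) z))) \<and>
     (\<forall>s t i. smooth_on s V \<and> smooth_on t V \<longrightarrow>
        (\<forall>z\<in>V.
           dz i (\<lambda>w. herm (H w) (s w) (t w)) z =
             herm (H z) (nabla P i s z) (t z) + herm (H z) (s z) (nablabar Q i t z) \<and>
           dzbar i (\<lambda>w. herm (H w) (s w) (t w)) z =
             herm (H z) (nablabar Q i s z) (t z) + herm (H z) (s z) (nabla P i t z)))"

text \<open>Existence, and uniqueness on \<open>V\<close>, are proved below.\<close>

definition chern_connection ::
  "(complex^('n::finite)) set \<Rightarrow> (complex^'n \<Rightarrow> complex^('r::finite)^'r)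
   \<Rightarrow> ('n \<Rightarrow> complex^'n \<Rightarrow> complex^'r^'r) \<times> ('n \<Rightarrow> complex^'n \<Rightarrow> complex^'r^'r)" where
  "chern_connection V H = (SOME PQ. is_chern_connection V H (fst PQ) (snd PQ))"

text \<open>\<open>curvature V H i j z $ \<gamma> $ \<alpha>\<close> is the coefficient of \<open>dz\<^sup>i \<and> d(cnj z\<^sup>j)\<close> in the \<open>e\<^sub>\<gamma>\<close>-component of
  \<open>\<nabla>\<^sup>2 e\<^sub>\<alpha>\<close>, that is, of \<open>nabla_i nablabar_j e\<^sub>\<alpha> - nablabar_j nabla_i e\<^sub>\<alpha>\<close> (coordinate fields commute).\<close>

definition curvature ::
  "(complex^('n::finite)) set \<Rightarrow> (complex^'n \<Rightarrow> complex^('r::finite)^'r) \<Rightarrow> 'n \<Rightarrow> 'n \<Rightarrow> complex^'n \<Rightarrow> complex^'r^'r" where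
  "curvature V H i j z =
     (let P = fst (chern_connection V H); Q = snd (chern_connection V H)
      in \<chi> \<gamma> \<alpha>. (nabla P i (nablabar Q j (\<lambda>_. axis \<alpha> 1)) z
                 - nablabar Q j (nabla P i (\<lambda>_. axis \<alpha> 1)) z) $ \<gamma>)"

definition lowered_curvature ::
  "(complex^('n::finite)) set \<Rightarrow> (complex^'n \<Rightarrow> complex^('r::finite)^'r) \<Rightarrow> 'n \<Rightarrow> 'n \<Rightarrow> complex^'n \<Rightarrow> complex^'r^'r" where
  "lowered_curvature V H i j z =
     (\<chi> \<alpha> \<beta>. \<Sum>\<gamma>\<in>UNIV. H z $ \<gamma> $ \<beta> * curvature V H i j z $ \<gamma> $ \<alpha>)"

section \<open>The Hermitian-Yang-Mills tensor\<close>

text \<open>The matrix of components of the tensor in a chart and a trivialization around \<open>x\<close>.  The inverse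
  metric is normalized by \<open>g\<^sup>i\<^sup>j g\<^sub>k\<^sub>j = \<delta>\<^sup>i\<^sub>k\<close>, so it is the transpose of the inverse matrix.\<close>

definition hym_matrix ::
  "(('m, 'n::finite) chart \<Rightarrow> 'm \<Rightarrow> complex^'n^'n) \<Rightarrow> 'e topology \<Rightarrow> ('e \<Rightarrow> 'm)
   \<Rightarrow> ('e \<Rightarrow> 'e \<Rightarrow> complex) \<Rightarrow> ('m, 'n) chart \<Rightarrow> ('m, 'e, 'r::finite) triv \<Rightarrow> 'm \<Rightarrow> complex^'r^'r" where
  "hym_matrix g E \<pi> h c t x =
     (\<chi> \<alpha> \<beta>. \<Sum>i\<in>UNIV. \<Sum>j\<in>UNIV. matrix_inv (g c x) $ j $ i *
        lowered_curvature (snd c ` (fst c \<inter> fst t)) (\<lambda>z. gram E \<pi> t h (chart_inv c z))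
          i j (snd c x) $ \<alpha> $ \<beta>)"

text \<open>The tensor as a form on the fibres.  Its components transform as those of a tensor, so the
  value does not depend on the chart and the trivialization that are chosen.\<close>

definition hym_tensor ::
  "('m, 'n::finite) chart set \<Rightarrow> (('m, 'n) chart \<Rightarrow> 'm \<Rightarrow> complex^'n^'n) \<Rightarrow> 'e topology \<Rightarrow> ('e \<Rightarrow> 'm)
   \<Rightarrow> ('m, 'e, 'r::finite) triv set \<Rightarrow> ('e \<Rightarrow> 'e \<Rightarrow> complex) \<Rightarrow> 'e \<Rightarrow> 'e \<Rightarrow> complex" where
  "hym_tensor A g E \<pi> T h v w =
     (let x = \<pi> v; c = (SOME c. c \<in> A \<and> x \<in> fst c); t = (SOME t. t \<in> T \<and> x \<in> fst t)
      in herm (hym_matrix g E \<pi> h c t x) (snd t v) (snd t w))"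

section \<open>Order on Hermitian forms on the fibres\<close>

text \<open>\<open>v\<close> ranges over the vectors of all fibres; on the diagonal Hermitian forms are real.\<close>

definition form_le ::
  "'e topology \<Rightarrow> ('e \<Rightarrow> 'e \<Rightarrow> complex) \<Rightarrow> ('e \<Rightarrow> 'e \<Rightarrow> complex) \<Rightarrow> bool" where
  "form_le E K L \<longleftrightarrow> (\<forall>v\<in>topspace E. Re (K v v) \<le> Re (L v v))"

definition form_pos ::
  "'e topology \<Rightarrow> ('e \<Rightarrow> 'm) \<Rightarrow> ('m, 'e, 'r::finite) triv set \<Rightarrow> ('e \<Rightarrow> 'e \<Rightarrow> complex) \<Rightarrow> bool" where
  "form_pos E \<pi> T K \<longleftrightarrow>
     (\<forall>v\<in>topspace E. \<forall>t\<in>T. \<pi> v \<in> fst t \<and> snd t v \<noteq> 0 \<longrightarrow> 0 < Re (K v v))"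

section \<open>Existence and uniqueness of the Chern connection\<close>

lemma C_k_on_cong:
  assumes "open S" "\<And>z. z \<in> S \<Longrightarrow> f z = g z" "C_k_on k f S"
  shows "C_k_on k g S"
  using assms(2,3)
proof (induction k arbitrary: f g)
  case 0
  then show ?case using continuous_on_cong[of S S f g] by simp
next
  case (Suc k)
  have d: "f differentiable at z" if "z \<in> S" for z using Suc.prems that by simp
  have dg: "g differentiable at z" if "z \<in> S" for z
    using d[OF that] has_derivative_transform_within_open[OF _ assms(1) that] Suc.prems(1)
    unfolding differentiable_def by blast
  have e: "frechet_derivative f (at z) = frechet_derivative g (at z)" if "z \<in> S" for z
    using frechet_derivative_transform_within_open[OF d[OF that] assms(1) that] Suc.prems(1) by blast
  show ?case using dg Suc.IH[of "\<lambda>z. frechet_derivative f (at z) v" "\<lambda>z. frechet_derivative g (at z) v" for v]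
      e Suc.prems(2) by simp
qed

lemma C_k_on_SucD: "C_k_on (Suc k) f S \<Longrightarrow> C_k_on k f S"
proof (induction k arbitrary: f)
  case 0
  then show ?case
    by (auto intro!: continuous_at_imp_continuous_on differentiable_imp_continuous_within)
next
  case (Suc k)
  then show ?case using C_k_on.simps(2) by metis
qed

lemma C_k_on_const: "C_k_on k (\<lambda>_. c) S"
  by (induction k arbitrary: c) auto

lemma C_k_on_add:
  assumes "open S" "C_k_on k f S" "C_k_on k g S"
  shows "C_k_on k (\<lambda>z. f z + g z) S"
  using assms(2,3)
proof (induction k arbitrary: f g)
  case 0
  then show ?case by (auto intro: continuous_on_add)
next
  case (Suc k)
  have D: "frechet_derivative (\<lambda>z. f z + g z) (at z) = (\<lambda>v. frechet_derivative f (at z) v + frechet_derivative g (at z) v)"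
    if "z \<in> S" for z
    using Suc.prems that
    by (intro frechet_derivative_at[symmetric] has_derivative_add) (auto simp: frechet_derivative_works)
  have "C_k_on k (\<lambda>z. frechet_derivative f (at z) v + frechet_derivative g (at z) v) S" for v
    using Suc.prems by (intro Suc.IH) auto
  then have "C_k_on k (\<lambda>z. frechet_derivative (\<lambda>z. f z + g z) (at z) v) S" for v
    using C_k_on_cong[OF assms(1), of "\<lambda>z. frechet_derivative f (at z) v + frechet_derivative g (at z) v"
        "\<lambda>z. frechet_derivative (\<lambda>z. f z + g z) (at z) v" k] D by simp
  then show ?case using Suc.prems by auto
qed

lemma C_k_on_mult:
  fixes f g :: "'a::real_normed_vector \<Rightarrow> 'b::real_normed_field"
  assumes "open S" "C_k_on k f S" "C_k_on k g S"
  shows "C_k_on k (\<lambda>z. f z * g z) S"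
  using assms(2,3)
proof (induction k arbitrary: f g)
  case 0
  then show ?case by (auto intro: continuous_on_mult)
next
  case (Suc k)
  have "frechet_derivative (\<lambda>z. f z * g z) (at z) = (\<lambda>v. f z * frechet_derivative g (at z) v + frechet_derivative f (at z) v * g z)"
    if "z \<in> S" for z
    using Suc.prems that
    by (intro frechet_derivative_at[symmetric] has_derivative_mult) (auto simp: frechet_derivative_works)
  moreover have "C_k_on k (\<lambda>z. f z * frechet_derivative g (at z) v + frechet_derivative f (at z) v * g z) S" for v
    using Suc.prems C_k_on_SucD[OF Suc.prems(1)] C_k_on_SucD[OF Suc.prems(2)]
    by (intro C_k_on_add[OF assms(1)] Suc.IH) auto
  ultimately have "C_k_on k (\<lambda>z. frechet_derivative (\<lambda>z. f z * g z) (at z) v) S" for v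
    using C_k_on_cong[OF assms(1), of "\<lambda>z. f z * frechet_derivative g (at z) v + frechet_derivative f (at z) v * g z"
        "\<lambda>z. frechet_derivative (\<lambda>z. f z * g z) (at z) v" k] by simp
  then show ?case using Suc.prems by auto
qed

lemma C_k_on_inverse:
  fixes f :: "'a::real_normed_vector \<Rightarrow> 'b::real_normed_field"
  assumes "open S" "C_k_on k f S" "\<And>z. z \<in> S \<Longrightarrow> f z \<noteq> 0"
  shows "C_k_on k (\<lambda>z. inverse (f z)) S"
  using assms(2)
proof (induction k)
  case 0
  then show ?case using assms(3) by (auto intro: continuous_on_inverse)
next
  case (Suc k)
  have D: "((\<lambda>z. inverse (f z)) has_derivative
      (\<lambda>v. - (inverse (f z) * frechet_derivative f (at z) v * inverse (f z)))) (at z)"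
    if "z \<in> S" for z
    using Suc.prems that assms(3)[OF that]
    by (intro Deriv.has_derivative_inverse) (auto simp: frechet_derivative_works)
  have I: "C_k_on k (\<lambda>z. inverse (f z)) S" using Suc.IH C_k_on_SucD[OF Suc.prems] by blast
  have "C_k_on k (\<lambda>z. (- 1) * (inverse (f z) * frechet_derivative f (at z) v * inverse (f z))) S" for v
    using Suc.prems by (intro C_k_on_mult[OF assms(1)] I C_k_on_const) auto
  then have "C_k_on k (\<lambda>z. frechet_derivative (\<lambda>z. inverse (f z)) (at z) v) S" for v
    using C_k_on_cong[OF assms(1), of "\<lambda>z. (- 1) * (inverse (f z) * frechet_derivative f (at z) v * inverse (f z))"
        "\<lambda>z. frechet_derivative (\<lambda>z. inverse (f z)) (at z) v" k] by (simp flip: frechet_derivative_at[OF D])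
  then show ?case using D by (auto simp: differentiable_def)
qed

lemma smooth_on_const: "smooth_on (\<lambda>_. c) S"
  by (simp add: smooth_on_def C_k_on_const)

lemma smooth_on_add: "open S \<Longrightarrow> smooth_on f S \<Longrightarrow> smooth_on g S \<Longrightarrow> smooth_on (\<lambda>z. f z + g z) S"
  by (simp add: smooth_on_def C_k_on_add)

lemma smooth_on_mult:
  fixes f g :: "'a::real_normed_vector \<Rightarrow> 'b::real_normed_field"
  shows "open S \<Longrightarrow> smooth_on f S \<Longrightarrow> smooth_on g S \<Longrightarrow> smooth_on (\<lambda>z. f z * g z) S"
  by (simp add: smooth_on_def C_k_on_mult)

lemma smooth_on_divide:
  fixes f g :: "'a::real_normed_vector \<Rightarrow> 'b::real_normed_field"
  shows "open S \<Longrightarrow> smooth_on f S \<Longrightarrow> smooth_on g S \<Longrightarrow> (\<And>z. z \<in> S \<Longrightarrow> g z \<noteq> 0)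
    \<Longrightarrow> smooth_on (\<lambda>z. f z / g z) S"
  by (simp add: smooth_on_def C_k_on_mult C_k_on_inverse divide_inverse)

lemma smooth_on_sum:
  "finite I \<Longrightarrow> open S \<Longrightarrow> (\<And>i. i \<in> I \<Longrightarrow> smooth_on (f i) S) \<Longrightarrow> smooth_on (\<lambda>z. \<Sum>i\<in>I. f i z) S"
  by (induction I rule: finite_induct) (auto intro: smooth_on_const smooth_on_add)

lemma smooth_on_prod:
  fixes f :: "'i \<Rightarrow> 'a::real_normed_vector \<Rightarrow> 'b::real_normed_field"
  shows "finite I \<Longrightarrow> open S \<Longrightarrow> (\<And>i. i \<in> I \<Longrightarrow> smooth_on (f i) S) \<Longrightarrow> smooth_on (\<lambda>z. \<Prod>i\<in>I. f i z) S"
  by (induction I rule: finite_induct) (auto intro: smooth_on_const smooth_on_mult)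

lemma smooth_on_det:
  fixes M :: "'a::real_normed_vector \<Rightarrow> complex^'r^'r"
  assumes "open S" "\<And>i j. smooth_on (\<lambda>z. M z $ i $ j) S"
  shows "smooth_on (\<lambda>z. det (M z)) S"
  unfolding det_def using assms
  by (intro smooth_on_sum smooth_on_mult smooth_on_prod smooth_on_const) (auto simp: finite_permutations)

lemma smooth_on_differentiable: "smooth_on f S \<Longrightarrow> z \<in> S \<Longrightarrow> f differentiable at z"
  unfolding smooth_on_def by (metis C_k_on.simps(2))

lemma smooth_on_frechet: "smooth_on f S \<Longrightarrow> smooth_on (\<lambda>z. frechet_derivative f (at z) v) S"
  unfolding smooth_on_def by (metis C_k_on.simps(2))

lemma smooth_on_dz: "open S \<Longrightarrow> smooth_on f S \<Longrightarrow> smooth_on (dz i f) S"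
proof -
  assume S: "open S" "smooth_on f S"
  have "smooth_on (\<lambda>z. frechet_derivative f (at z) (axis i 1) * (1/2)
      + frechet_derivative f (at z) (axis i \<i>) * (- \<i> / 2)) S"
    using S by (intro smooth_on_add smooth_on_mult smooth_on_const smooth_on_frechet)
  moreover have "dz i f = (\<lambda>z. frechet_derivative f (at z) (axis i 1) * (1/2)
      + frechet_derivative f (at z) (axis i \<i>) * (- \<i> / 2))"
    by (auto simp: dz_def fun_eq_iff field_simps)
  ultimately show ?thesis by simp
qed

lemma dz_const: "dz i (\<lambda>_. c) z = 0" and dzbar_const: "dzbar i (\<lambda>_. c) z = 0"
  by (simp_all add: dz_def dzbar_def)

lemma dz_mult:
  assumes "f differentiable at z" "g differentiable at z"
  shows "dz i (\<lambda>w. f w * g w) z = dz i f z * g z + f z * dz i g z"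
    and "dzbar i (\<lambda>w. f w * g w) z = dzbar i f z * g z + f z * dzbar i g z"
proof -
  have "frechet_derivative (\<lambda>z. f z * g z) (at z)
      = (\<lambda>v. f z * frechet_derivative g (at z) v + frechet_derivative f (at z) v * g z)"
    using assms
    by (intro frechet_derivative_at[symmetric] has_derivative_mult) (auto simp: frechet_derivative_works)
  then show "dz i (\<lambda>w. f w * g w) z = dz i f z * g z + f z * dz i g z"
    and "dzbar i (\<lambda>w. f w * g w) z = dzbar i f z * g z + f z * dzbar i g z"
    by (simp_all add: dz_def dzbar_def field_simps)
qed

lemma dz_sum:
  assumes "\<And>a. a \<in> I \<Longrightarrow> f a differentiable at z"
  shows "dz i (\<lambda>w. \<Sum>a\<in>I. f a w) z = (\<Sum>a\<in>I. dz i (f a) z)"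
    and "dzbar i (\<lambda>w. \<Sum>a\<in>I. f a w) z = (\<Sum>a\<in>I. dzbar i (f a) z)"
proof -
  have "frechet_derivative (\<lambda>w. \<Sum>a\<in>I. f a w) (at z) = (\<lambda>v. \<Sum>a\<in>I. frechet_derivative (f a) (at z) v)"
    using assms
    by (intro frechet_derivative_at[symmetric] has_derivative_sum) (auto simp: frechet_derivative_works)
  then show "dz i (\<lambda>w. \<Sum>a\<in>I. f a w) z = (\<Sum>a\<in>I. dz i (f a) z)"
    and "dzbar i (\<lambda>w. \<Sum>a\<in>I. f a w) z = (\<Sum>a\<in>I. dzbar i (f a) z)"
    by (simp_all add: dz_def dzbar_def sum_subtractf sum.distrib sum_distrib_left sum_divide_distrib
        diff_divide_distrib add_divide_distrib)
qed

lemma differentiable_cnj_fun: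
  "f differentiable at z \<Longrightarrow> (\<lambda>w. cnj (f w)) differentiable at z"
  by (metis differentiable_def has_derivative_cnj)

lemma dz_cnj:
  assumes "f differentiable at z"
  shows "dz i (\<lambda>w. cnj (f w)) z = cnj (dzbar i f z)"
    and "dzbar i (\<lambda>w. cnj (f w)) z = cnj (dz i f z)"
proof -
  have "frechet_derivative (\<lambda>w. cnj (f w)) (at z) = (\<lambda>v. cnj (frechet_derivative f (at z) v))"
    using assms
    by (intro frechet_derivative_at[symmetric] has_derivative_cnj) (auto simp: frechet_derivative_works)
  then show "dz i (\<lambda>w. cnj (f w)) z = cnj (dzbar i f z)"
    and "dzbar i (\<lambda>w. cnj (f w)) z = cnj (dz i f z)"
    by (simp_all add: dz_def dzbar_def)
qed

lemma dzbar_cong_open: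
  assumes "open S" "z \<in> S" "f differentiable at z" "\<And>w. w \<in> S \<Longrightarrow> f w = g w"
  shows "dzbar i f z = dzbar i g z"
  using frechet_derivative_transform_within_open[OF assms(3,1,2,4)] by (simp add: dzbar_def)

lemma herm_axis: "herm H s (axis \<beta> 1) = (\<Sum>\<alpha>\<in>UNIV. H $ \<alpha> $ \<beta> * s $ \<alpha>)"
proof -
  have "(\<Sum>b\<in>UNIV. H $ a $ b * s $ a * cnj (axis \<beta> 1 $ b)) = H $ a $ \<beta> * s $ a" for a
    by (subst sum.remove[of _ \<beta>]) (auto simp: axis_def intro!: sum.neutral)
  then show ?thesis by (simp add: herm_def)
qed

lemma herm_expand: "herm H s t = (\<Sum>\<beta>\<in>UNIV. herm H s (axis \<beta> 1) * cnj (t $ \<beta>))"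
  unfolding herm_axis unfolding herm_def by (subst sum.swap) (simp add: sum_distrib_right)

lemma herm_add:
  "herm H (s + s') t = herm H s t + herm H s' t" "herm H s (t + t') = herm H s t + herm H s t'"
  "herm H (s - s') t = herm H s t - herm H s' t"
  by (simp_all add: herm_def algebra_simps sum.distrib sum_subtractf)

lemma hermitian_pos_def_nondegenerate:
  assumes "hermitian_pos_def H" "\<And>\<beta>. herm H s (axis \<beta> 1) = 0"
  shows "s = 0"
  using assms herm_expand[of H s s] unfolding hermitian_pos_def_def by force

lemma herm_cnj:
  assumes "hermitian_pos_def H"
  shows "cnj (herm H s t) = herm H t s"
proof -
  have "H $ b $ a = cnj (H $ a $ b)" for a b
    using assms unfolding hermitian_pos_def_def by blast
  then have "cnj (H $ a $ b) * cnj (s $ a) * t $ b = H $ b $ a * t $ b * cnj (s $ a)" for a b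
    by (metis mult.assoc mult.commute)
  then have "(\<Sum>a\<in>UNIV. \<Sum>b\<in>UNIV. cnj (H $ a $ b) * cnj (s $ a) * t $ b)
      = (\<Sum>a\<in>UNIV. \<Sum>b\<in>UNIV. H $ b $ a * t $ b * cnj (s $ a))"
    by (intro sum.cong refl)
  then show ?thesis unfolding herm_def by (subst (2) sum.swap) (simp only: cnj_sum complex_cnj_mult complex_cnj_cnj)
qed

lemma hermitian_pos_def_det:
  assumes "hermitian_pos_def H"
  shows "det (transpose H) \<noteq> 0"
proof -
  have "x = 0" if "transpose H *v x = 0" for x
  proof -
    have "(\<Sum>\<alpha>\<in>UNIV. H $ \<alpha> $ \<beta> * x $ \<alpha>) = 0" for \<beta>
      using that by (simp add: vec_eq_iff matrix_vector_mult_def transpose_def)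
    then show ?thesis by (intro hermitian_pos_def_nondegenerate[OF assms]) (simp add: herm_axis)
  qed
  then have "invertible (transpose H)"
    unfolding invertible_left_inverse matrix_left_invertible_ker by blast
  then show ?thesis by (simp only: invertible_det_nz simp_thms)
qed

lemma matrix_mult_axis: "((M :: complex^'r^'r) *v axis \<alpha> 1) $ \<gamma> = M $ \<gamma> $ \<alpha>"
proof -
  have "(\<Sum>b\<in>UNIV. M $ \<gamma> $ b * axis \<alpha> 1 $ b) = M $ \<gamma> $ \<alpha>"
    by (subst sum.remove[of _ \<alpha>]) (auto simp: axis_def intro!: sum.neutral)
  then show ?thesis by (simp add: matrix_vector_mult_def)
qed

theorem chern_connection_unique:
  assumes "is_chern_connection V H P Q" "is_chern_connection V H P' Q'"
    and "z \<in> V" "hermitian_pos_def (H z)"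
  shows "P i z = P' i z" "Q i z = Q' i z"
proof -
  have ax: "(\<chi> \<gamma>. dzbar i (\<lambda>w. axis \<alpha> (1::complex) $ \<gamma>) z) = 0"
    "(\<chi> \<gamma>. dz i (\<lambda>w. axis \<alpha> (1::complex) $ \<gamma>) z) = 0" for \<alpha> :: 'b
    by (simp_all add: vec_eq_iff dz_const dzbar_const)
  have Q2: "nablabar R i (\<lambda>_. axis \<alpha> 1) z = 0"
    if "is_chern_connection V H N R" for \<alpha> N R
  proof -
    have "nablabar R i (\<lambda>_. axis \<alpha> 1) z = (\<chi> \<gamma>. dzbar i (\<lambda>w. axis \<alpha> (1::complex) $ \<gamma>) z)"
      using that assms(3) smooth_on_const[of "axis \<alpha> (1::complex)" V]
      unfolding is_chern_connection_def by blast
    then show ?thesis using ax by simp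
  qed
  then have Q1: "R i z *v axis \<alpha> 1 = 0" if "is_chern_connection V H N R" for \<alpha> N R
    using that unfolding nablabar_def ax by simp
  have P: "dz i (\<lambda>w. herm (H w) (axis \<alpha> 1) (axis \<beta> 1)) z = herm (H z) (N i z *v axis \<alpha> 1) (axis \<beta> 1)"
    if "is_chern_connection V H N R" for \<alpha> \<beta> N R
  proof -
    have "dz i (\<lambda>w. herm (H w) (axis \<alpha> 1) (axis \<beta> 1)) z
       = herm (H z) (nabla N i (\<lambda>_. axis \<alpha> 1) z) (axis \<beta> 1)
         + herm (H z) (axis \<alpha> 1) (nablabar R i (\<lambda>_. axis \<beta> 1) z)"
      using that assms(3) smooth_on_const unfolding is_chern_connection_def by blast
    then show ?thesis unfolding Q2[OF that] by (simp add: nabla_def ax herm_def)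
  qed
  have "P i z *v axis \<alpha> 1 - P' i z *v axis \<alpha> 1 = 0" for \<alpha>
    using P[OF assms(1)] P[OF assms(2)]
    by (intro hermitian_pos_def_nondegenerate[OF assms(4)]) (simp add: herm_add)
  then show "P i z = P' i z"
    by (simp add: vec_eq_iff matrix_mult_axis)
  show "Q i z = Q' i z"
    using Q1[OF assms(1)] Q1[OF assms(2)]
    by (simp add: vec_eq_iff matrix_mult_axis)
qed

theorem chern_connection_exists:
  fixes V :: "(complex^'n) set" and H :: "complex^'n \<Rightarrow> complex^'r^'r"
  assumes V: "open V" and H: "\<And>\<alpha> \<beta>. smooth_on (\<lambda>z. H z $ \<alpha> $ \<beta>) V"
    and pos: "\<And>z. z \<in> V \<Longrightarrow> hermitian_pos_def (H z)"
  shows "is_chern_connection V H (fst (chern_connection V H)) (snd (chern_connection V H))"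
proof -
  define P :: "'n \<Rightarrow> complex^'n \<Rightarrow> complex^'r^'r" where
    "P i z = (\<chi> \<gamma> \<alpha>. det (\<chi> a b. if b = \<gamma> then dz i (\<lambda>w. H w $ \<alpha> $ a) z else H z $ b $ a)
               / det (transpose (H z)))" for i z
  define Q :: "'n \<Rightarrow> complex^'n \<Rightarrow> complex^'r^'r" where "Q i z = 0" for i z
  have smP: "smooth_on (\<lambda>z. P i z $ \<gamma> $ \<alpha>) V" for i \<gamma> \<alpha>
  proof -
    have "smooth_on (\<lambda>z. if b = \<gamma> then dz i (\<lambda>w. H w $ \<alpha> $ a) z else H z $ b $ a) V" for a b
      using smooth_on_dz[OF V H[of \<alpha> a]] H by (cases "b = \<gamma>") auto
    then have "smooth_on (\<lambda>z. det ((\<chi> a b. if b = \<gamma> then dz i (\<lambda>w. H w $ \<alpha> $ a) z else H z $ b $ a) :: complex^'r^'r)) V"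
      by (intro smooth_on_det V) simp
    moreover have "smooth_on (\<lambda>z. det (transpose (H z))) V"
      using H by (intro smooth_on_det V) (simp add: transpose_def)
    ultimately have "smooth_on (\<lambda>z. det ((\<chi> a b. if b = \<gamma> then dz i (\<lambda>w. H w $ \<alpha> $ a) z else H z $ b $ a) :: complex^'r^'r)
        / det (transpose (H z))) V"
      using hermitian_pos_def_det[OF pos] by (rule smooth_on_divide[OF V])
    then show ?thesis by (simp add: P_def)
  qed
  have key: "(\<Sum>\<gamma>\<in>UNIV. H z $ \<gamma> $ \<beta> * P i z $ \<gamma> $ \<alpha>) = dz i (\<lambda>w. H w $ \<alpha> $ \<beta>) z"
    if "z \<in> V" for z i \<alpha> \<beta>
  proof -
    have "transpose (H z) *v (\<chi> \<gamma>. P i z $ \<gamma> $ \<alpha>) = (\<chi> \<beta>. dz i (\<lambda>w. H w $ \<alpha> $ \<beta>) z)"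
      using cramer[OF hermitian_pos_def_det[OF pos[OF that]],
          of "\<chi> \<gamma>. P i z $ \<gamma> $ \<alpha>" "\<chi> \<beta>. dz i (\<lambda>w. H w $ \<alpha> $ \<beta>) z"]
      by (simp add: P_def transpose_def cong: if_cong)
    then show ?thesis by (simp add: vec_eq_iff matrix_vector_mult_def transpose_def)
  qed
  have nb: "nablabar Q i s z = (\<chi> \<gamma>. dzbar i (\<lambda>w. s w $ \<gamma>) z)" for i s z
    by (simp add: nablabar_def Q_def)
  have comp1: "dz i (\<lambda>w. herm (H w) (s w) (t w)) z =
      herm (H z) (nabla P i s z) (t z) + herm (H z) (s z) (nablabar Q i t z)"
    if st: "smooth_on s V" "smooth_on t V" and z: "z \<in> V" for s t i z
  proof -
    have dH: "(\<lambda>w. H w $ \<alpha> $ \<beta>) differentiable at z" for \<alpha> \<beta>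
      using smooth_on_differentiable[OF H z] .
    have ds: "(\<lambda>w. s w $ \<alpha>) differentiable at z" for \<alpha>
      using smooth_on_differentiable[OF st(1) z] unfolding differentiable_def
      by (blast intro: bounded_linear.has_derivative[OF bounded_linear_vec_nth])
    have dt: "(\<lambda>w. t w $ \<alpha>) differentiable at z" for \<alpha>
      using smooth_on_differentiable[OF st(2) z] unfolding differentiable_def
      by (blast intro: bounded_linear.has_derivative[OF bounded_linear_vec_nth])
    have dct: "(\<lambda>w. cnj (t w $ \<alpha>)) differentiable at z" for \<alpha>
      using dt[of \<alpha>] by (rule differentiable_cnj_fun)
    have P: "(\<Sum>\<alpha>\<in>UNIV. \<Sum>\<beta>\<in>UNIV. dz i (\<lambda>w. H w $ \<alpha> $ \<beta>) z * s z $ \<alpha> * cnj (t z $ \<beta>))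
       = herm (H z) (P i z *v s z) (t z)"
    proof -
      have "herm (H z) (P i z *v s z) (t z) = (\<Sum>\<gamma>\<in>UNIV. \<Sum>\<beta>\<in>UNIV. \<Sum>\<alpha>\<in>UNIV.
            H z $ \<gamma> $ \<beta> * P i z $ \<gamma> $ \<alpha> * (s z $ \<alpha> * cnj (t z $ \<beta>)))"
        by (simp add: herm_def matrix_vector_mult_def sum_distrib_left sum_distrib_right mult_ac)
      also have "\<dots> = (\<Sum>\<beta>\<in>UNIV. \<Sum>\<gamma>\<in>UNIV. \<Sum>\<alpha>\<in>UNIV.
            H z $ \<gamma> $ \<beta> * P i z $ \<gamma> $ \<alpha> * (s z $ \<alpha> * cnj (t z $ \<beta>)))"
        by (rule sum.swap)
      also have "\<dots> = (\<Sum>\<beta>\<in>UNIV. \<Sum>\<alpha>\<in>UNIV. \<Sum>\<gamma>\<in>UNIV.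
            H z $ \<gamma> $ \<beta> * P i z $ \<gamma> $ \<alpha> * (s z $ \<alpha> * cnj (t z $ \<beta>)))"
        by (intro sum.cong refl sum.swap)
      also have "\<dots> = (\<Sum>\<beta>\<in>UNIV. \<Sum>\<alpha>\<in>UNIV. dz i (\<lambda>w. H w $ \<alpha> $ \<beta>) z * (s z $ \<alpha> * cnj (t z $ \<beta>)))"
        by (simp add: key[OF z] flip: sum_distrib_right)
      also have "\<dots> = (\<Sum>\<alpha>\<in>UNIV. \<Sum>\<beta>\<in>UNIV. dz i (\<lambda>w. H w $ \<alpha> $ \<beta>) z * (s z $ \<alpha> * cnj (t z $ \<beta>)))"
        by (rule sum.swap)
      finally show ?thesis by (simp add: mult_ac)
    qed
    have "dz i (\<lambda>w. herm (H w) (s w) (t w)) z = (\<Sum>\<alpha>\<in>UNIV. \<Sum>\<beta>\<in>UNIV.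
        dz i (\<lambda>w. H w $ \<alpha> $ \<beta>) z * s z $ \<alpha> * cnj (t z $ \<beta>)
        + H z $ \<alpha> $ \<beta> * dz i (\<lambda>w. s w $ \<alpha>) z * cnj (t z $ \<beta>)
        + H z $ \<alpha> $ \<beta> * s z $ \<alpha> * cnj (dzbar i (\<lambda>w. t w $ \<beta>) z))"
      unfolding herm_def
      by (simp add: dz_sum dz_mult dz_cnj dH ds dt dct differentiable_mult differentiable_sum algebra_simps)
    also have "\<dots> = herm (H z) (P i z *v s z) (t z)
        + herm (H z) (\<chi> \<gamma>. dz i (\<lambda>w. s w $ \<gamma>) z) (t z)
        + herm (H z) (s z) (\<chi> \<gamma>. dzbar i (\<lambda>w. t w $ \<gamma>) z)"
      unfolding sum.distrib P by (simp add: herm_def)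
    finally show ?thesis unfolding nb by (simp add: nabla_def herm_add)
  qed
  have comp2: "dzbar i (\<lambda>w. herm (H w) (s w) (t w)) z =
      herm (H z) (nablabar Q i s z) (t z) + herm (H z) (s z) (nabla P i t z)"
    if st: "smooth_on s V" "smooth_on t V" and z: "z \<in> V" for s t i z
  proof -
    have dH: "(\<lambda>w. H w $ \<alpha> $ \<beta>) differentiable at z" for \<alpha> \<beta>
      using smooth_on_differentiable[OF H z] .
    have ds: "(\<lambda>w. s w $ \<alpha>) differentiable at z" for \<alpha>
      using smooth_on_differentiable[OF st(1) z] unfolding differentiable_def
      by (blast intro: bounded_linear.has_derivative[OF bounded_linear_vec_nth])
    have dt: "(\<lambda>w. t w $ \<alpha>) differentiable at z" for \<alpha>
      using smooth_on_differentiable[OF st(2) z] unfolding differentiable_def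
      by (blast intro: bounded_linear.has_derivative[OF bounded_linear_vec_nth])
    have dct: "(\<lambda>w. cnj (s w $ \<alpha>)) differentiable at z" for \<alpha>
      using ds[of \<alpha>] by (rule differentiable_cnj_fun)
    have d: "(\<lambda>w. herm (H w) (t w) (s w)) differentiable at z"
      unfolding herm_def by (simp add: dH dt dct differentiable_mult differentiable_sum)
    have dc: "(\<lambda>w. cnj (herm (H w) (t w) (s w))) differentiable at z"
      using d by (rule differentiable_cnj_fun)
    have "dzbar i (\<lambda>w. herm (H w) (s w) (t w)) z = dzbar i (\<lambda>w. cnj (herm (H w) (t w) (s w))) z"
      by (rule dzbar_cong_open[OF V z dc, symmetric]) (rule herm_cnj[OF pos])
    also have "\<dots> = cnj (dz i (\<lambda>w. herm (H w) (t w) (s w)) z)"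
      using dz_cnj(2)[OF d] .
    also have "\<dots> = herm (H z) (s z) (nabla P i t z) + herm (H z) (nablabar Q i s z) (t z)"
      by (simp add: comp1[OF st(2,1) z] herm_cnj[OF pos[OF z]])
    finally show ?thesis by (simp add: add.commute)
  qed
  have "is_chern_connection V H P Q"
    unfolding is_chern_connection_def
  proof (intro conjI allI impI ballI)
    show "smooth_on (\<lambda>z. Q i z $ \<alpha> $ \<beta>) V" for i \<alpha> \<beta>
      by (simp add: Q_def smooth_on_const)
  qed (use smP nb comp1 comp2 in blast)+
  then have "is_chern_connection V H (fst (P, Q)) (snd (P, Q))" by simp
  then show ?thesis
    unfolding chern_connection_def
    by (rule someI[of "\<lambda>PQ. is_chern_connection V H (fst PQ) (snd PQ)"])
qed

end

theory Submission
  imports Defs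
begin

text \<open>
  The proof is a maximum principle for the largest ratio of the two metrics.  The maximum over the fibre
  over \<open>x\<close> of \<open>h(v, v) / h0(v, v)\<close>, \<open>v \<noteq> 0\<close>, is an upper semicontinuous function of \<open>x\<close>, so on the compact
  base it attains its largest value \<open>lam\<close>; let \<open>v\<close> over \<open>x0\<close> be a vector that realizes it
  (\<open>max_ratio_attained\<close>).  The claim is \<open>lam \<le> 1\<close>.

  Near \<open>x0\<close> choose a holomorphic section \<open>s\<close> with \<open>s(x0) = v\<close> that is parallel at \<open>x0\<close> for the Chern
  connection of \<open>h0\<close>; a section affine in coordinates suffices.  The function
  \<open>F = lam h0(s, s) - h(s, s)\<close> is nonnegative and vanishes at \<open>x0\<close>, so its complex Hessian at \<open>x0\<close> is positive
  semidefinite (\<open>complex_hessian_at_min\<close>), and so is nonnegative the trace of the Hessian with the positive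
  matrix \<open>g\<^sup>i\<^sup>j\<close>, which is a sum of rank one matrices (\<open>psd_rank_one_decomposition\<close>).  On the other hand the
  complex Hessian of \<open>h(s, s)\<close> is \<open>h(\<nabla>\<^sub>i s, \<nabla>\<^sub>j s) - R\<^sub>i\<^sub>j(s, s)\<close>
  (\<open>complex_hessian_herm_affine_section\<close>), and for \<open>h0\<close> the first term vanishes at \<open>x0\<close>.  Writing \<open>S(k)\<close> for the
  value at \<open>(v, v)\<close> of the Hermitian-Yang-Mills tensor of the metric \<open>k\<close>, the trace is \<open>S(h) - lam S(h0)\<close>
  minus a nonnegative term.  Hence
  \<open>lam S(h0) \<le> S(h)\<close> (\<open>hym_tensor_comparison_at_max\<close>), while \<open>S(h) \<le> S(h0)\<close> and \<open>S(h0) > 0\<close> by hypothesis, so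
  \<open>lam \<le> 1\<close>.
\<close>

section \<open>Smooth functions and directional derivatives\<close>

lemma C_k_on_bounded_linear_compose:
  assumes "open S" "bounded_linear L" "C_k_on k f S"
  shows "C_k_on k (\<lambda>z. L (f z)) S"
  using assms(3)
proof (induction k arbitrary: f)
  case 0
  then show ?case using assms(2) by (simp add: bounded_linear.continuous_on)
next
  case (Suc k)
  have D: "((\<lambda>z. L (f z)) has_derivative (\<lambda>v. L (frechet_derivative f (at z) v))) (at z)"
    if "z \<in> S" for z
    using Suc.prems that
    by (intro bounded_linear.has_derivative[OF assms(2)]) (auto simp: frechet_derivative_works)
  have "C_k_on k (\<lambda>z. frechet_derivative (\<lambda>z. L (f z)) (at z) v) S" for v
    using Suc.prems
    by (intro C_k_on_cong[OF assms(1) _ Suc.IH[of "\<lambda>z. frechet_derivative f (at z) v"]])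
      (auto simp flip: frechet_derivative_at[OF D])
  then show ?case using D by (auto simp: differentiable_def)
qed

lemma smooth_on_bounded_linear_compose:
  "open S \<Longrightarrow> bounded_linear L \<Longrightarrow> smooth_on f S \<Longrightarrow> smooth_on (\<lambda>z. L (f z)) S"
  by (simp add: smooth_on_def C_k_on_bounded_linear_compose)

lemma smooth_on_bounded_linear:
  assumes "bounded_linear f"
  shows "smooth_on f S"
proof -
  have D: "(f has_derivative f) (at z)" for z
    using assms by (rule bounded_linear_imp_has_derivative)
  have "C_k_on k f S" for k
    by (cases k) (auto simp: C_k_on_const linear_continuous_on[OF assms] differentiable_def intro: D
        simp flip: frechet_derivative_at[OF D])
  then show ?thesis by (simp add: smooth_on_def)
qed

lemma smooth_on_imp_continuous_on: "smooth_on f S \<Longrightarrow> continuous_on S f"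
  unfolding smooth_on_def by (drule spec[of _ 0]) simp

lemma bounded_linear_axis: "bounded_linear (axis i :: 'a::euclidean_space \<Rightarrow> 'a^'n::finite)"
proof -
  have "linear (axis i :: 'a \<Rightarrow> 'a^'n)"
    by (auto simp: linear_iff vec_eq_iff axis_def)
  then show ?thesis by (simp add: linear_conv_bounded_linear)
qed

lemma smooth_on_vec:
  fixes f :: "'a::real_normed_vector \<Rightarrow> ('b::euclidean_space)^'n::finite"
  assumes "open S" "\<And>i. smooth_on (\<lambda>z. f z $ i) S"
  shows "smooth_on f S"
proof -
  have "f = (\<lambda>z. \<Sum>i\<in>UNIV. axis i (f z $ i))"
    by (auto simp: fun_eq_iff vec_eq_iff axis_def)
  then show ?thesis
    using smooth_on_sum[of UNIV S "\<lambda>i z. axis i (f z $ i)"] assms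
      smooth_on_bounded_linear_compose[OF assms(1) bounded_linear_axis] by (metis finite)
qed

lemma dz_cong_open:
  assumes "open S" "z \<in> S" "f differentiable at z" "\<And>w. w \<in> S \<Longrightarrow> f w = g w"
  shows "dz i f z = dz i g z"
  using frechet_derivative_transform_within_open[OF assms(3,1,2,4)] by (simp add: dz_def)

lemma dz_cmult:
  assumes "f differentiable at z"
  shows "dz i (\<lambda>w. c * f w) z = c * dz i f z" "dzbar i (\<lambda>w. c * f w) z = c * dzbar i f z"
  using dz_mult[of "\<lambda>_. c" z f i] assms by (simp_all add: dz_const dzbar_const)

lemma dz_diff:
  assumes "f differentiable at z" "g differentiable at z"
  shows "dz i (\<lambda>w. f w - g w) z = dz i f z - dz i g z"
    and "dzbar i (\<lambda>w. f w - g w) z = dzbar i f z - dzbar i g z"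
proof -
  have "frechet_derivative (\<lambda>z. f z - g z) (at z)
      = (\<lambda>v. frechet_derivative f (at z) v - frechet_derivative g (at z) v)"
    using assms
    by (intro frechet_derivative_at[symmetric] has_derivative_diff) (auto simp: frechet_derivative_works)
  then show "dz i (\<lambda>w. f w - g w) z = dz i f z - dz i g z"
    and "dzbar i (\<lambda>w. f w - g w) z = dzbar i f z - dzbar i g z"
    by (simp_all add: dz_def dzbar_def field_simps)
qed

lemma vec_real_expand:
  fixes w :: "complex^'n::finite"
  shows "w = (\<Sum>i\<in>UNIV. Re (w $ i) *\<^sub>R axis i 1 + Im (w $ i) *\<^sub>R axis i \<i>)"
proof -
  have "(\<Sum>i\<in>UNIV. Re (w $ i) *\<^sub>R (axis i 1 :: complex^'n) $ j + Im (w $ i) *\<^sub>R axis i \<i> $ j)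
      = (\<Sum>i\<in>UNIV. if i = j then w $ j else 0)" for j
    by (intro sum.cong) (auto simp: axis_def complex_eq_iff)
  then show ?thesis by (simp add: vec_eq_iff)
qed

text \<open>Contracting the Wirtinger derivatives with a vector \<open>w\<close> gives the derivatives
  \<open>\<partial>\<^sub>w\<close> and its conjugate along the complex line spanned by \<open>w\<close>.\<close>

lemma dz_dzbar_direction:
  fixes f :: "complex^'n::finite \<Rightarrow> complex"
  assumes "f differentiable at z"
  shows "(\<Sum>i\<in>UNIV. w $ i * dz i f z)
      = (frechet_derivative f (at z) w - \<i> * frechet_derivative f (at z) (\<i> *s w)) / 2"
    and "(\<Sum>i\<in>UNIV. cnj (w $ i) * dzbar i f z)
      = (frechet_derivative f (at z) w + \<i> * frechet_derivative f (at z) (\<i> *s w)) / 2"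
proof -
  let ?D = "frechet_derivative f (at z)"
  have L: "linear ?D" using assms by (rule linear_frechet_derivative)
  have D: "?D v = (\<Sum>i\<in>UNIV. Re (v $ i) * ?D (axis i 1) + Im (v $ i) * ?D (axis i \<i>))" for v
    by (subst vec_real_expand[of v])
      (simp add: linear_sum[OF L] linear_add[OF L] linear_scale[OF L] scaleR_conv_of_real[where 'a = complex])
  have T: "w $ i * dz i f z = ((Re (w $ i) * ?D (axis i 1) + Im (w $ i) * ?D (axis i \<i>))
      - \<i> * (Re ((\<i> *s w) $ i) * ?D (axis i 1) + Im ((\<i> *s w) $ i) * ?D (axis i \<i>))) / 2"
    "cnj (w $ i) * dzbar i f z = ((Re (w $ i) * ?D (axis i 1) + Im (w $ i) * ?D (axis i \<i>))
      + \<i> * (Re ((\<i> *s w) $ i) * ?D (axis i 1) + Im ((\<i> *s w) $ i) * ?D (axis i \<i>))) / 2" for i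
    by (simp_all add: dz_def dzbar_def complex_eq_iff field_simps)
  show "(\<Sum>i\<in>UNIV. w $ i * dz i f z) = (?D w - \<i> * ?D (\<i> *s w)) / 2"
    unfolding D[of w] D[of "\<i> *s w"] T sum_distrib_left sum_subtractf[symmetric] sum_divide_distrib ..
  show "(\<Sum>i\<in>UNIV. cnj (w $ i) * dzbar i f z) = (?D w + \<i> * ?D (\<i> *s w)) / 2"
    unfolding D[of w] D[of "\<i> *s w"] T sum_distrib_left sum.distrib[symmetric] sum_divide_distrib ..
qed

section \<open>The complex Hessian at a minimum\<close>

lemma has_real_derivative_along_line:
  fixes F :: "'a::real_normed_vector \<Rightarrow> complex"
  assumes "F differentiable at (z + t *\<^sub>R u)"
  shows "((\<lambda>t. Re (F (z + t *\<^sub>R u))) has_real_derivative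
      Re (frechet_derivative F (at (z + t *\<^sub>R u)) u)) (at t)"
proof -
  let ?D = "frechet_derivative F (at (z + t *\<^sub>R u))"
  have "(F has_derivative ?D) (at (z + t *\<^sub>R u))"
    using assms by (simp add: frechet_derivative_works)
  moreover have "((\<lambda>t. z + t *\<^sub>R u) has_derivative (\<lambda>h. h *\<^sub>R u)) (at t)"
    by (auto intro!: derivative_eq_intros)
  ultimately have "((\<lambda>t. Re (F (z + t *\<^sub>R u))) has_derivative (\<lambda>h. Re (?D (h *\<^sub>R u)))) (at t)"
    using has_derivative_Re diff_chain_at[of "\<lambda>t. z + t *\<^sub>R u" _ t F] by (fastforce simp: o_def)
  moreover have "Re (?D (h *\<^sub>R u)) = Re (?D u) * h" for h
    using linear_frechet_derivative[OF assms] by (simp add: linear_scale)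
  ultimately show ?thesis by (simp add: has_field_derivative_def)
qed

lemma second_derivative_at_min:
  fixes F :: "'a::real_normed_vector \<Rightarrow> complex"
  assumes "open V" "z \<in> V" "smooth_on F V" and le: "\<And>w. w \<in> V \<Longrightarrow> Re (F z) \<le> Re (F w)"
  shows "0 \<le> Re (frechet_derivative (\<lambda>w. frechet_derivative F (at w) u) (at z) u)" (is "0 \<le> ?D")
proof (rule ccontr)
  assume neg: "\<not> 0 \<le> ?D"
  define f where "f t = Re (F (z + t *\<^sub>R u))" for t
  define f' where "f' t = Re (frechet_derivative F (at (z + t *\<^sub>R u)) u)" for t
  have "open ((\<lambda>t. z + t *\<^sub>R u) -` V)"
    using assms(1) by (intro open_vimage) (auto intro!: continuous_intros)
  then obtain d where d: "d > 0" "\<And>t. \<bar>t\<bar> < d \<Longrightarrow> z + t *\<^sub>R u \<in> V"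
    using assms(2) by (force elim!: openE[of _ 0] simp: subset_iff dist_real_def)
  have f: "(f has_real_derivative f' t) (at t)" if "\<bar>t\<bar> < d" for t
    unfolding f_def f'_def using smooth_on_differentiable[OF assms(3) d(2)[OF that]]
    by (rule has_real_derivative_along_line)
  have "(\<lambda>w. frechet_derivative F (at w) u) differentiable at (z + 0 *\<^sub>R u)"
    using smooth_on_differentiable[OF smooth_on_frechet[OF assms(3)]] assms(2) by simp
  from has_real_derivative_along_line[OF this]
  have f'': "(f' has_real_derivative ?D) (at 0)"
    by (simp add: f'_def[abs_def])
  have min: "f 0 \<le> f t" if "\<bar>t\<bar> < d" for t
    using le[OF d(2)[OF that]] by (simp add: f_def)
  have "f' 0 = 0"
    using DERIV_local_min[OF f[of 0] d(1)] d(1) min by simp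
  then obtain e where e: "e > 0" "\<And>t. 0 < t \<Longrightarrow> t < e \<Longrightarrow> f' t < 0"
    using DERIV_neg_dec_right[OF f''] neg by auto
  define t where "t = min d e / 2"
  have t: "0 < t" "t < d" "t < e" using d(1) e(1) by (auto simp: t_def)
  have "f t < f 0"
  proof -
    obtain x where x: "0 < x" "x < t" "f t - f 0 = (t - 0) * f' x"
      using MVT2[of 0 t f f'] t f by (metis abs_of_nonneg less_le_trans not_less order_le_less_trans)
    then have "(t - 0) * f' x < 0"
      using e(2)[of x] t by (intro mult_pos_neg) auto
    then show ?thesis using x by linarith
  qed
  with min[of t] t show False by simp
qed

lemma Im_frechet_derivative_eq_0:
  fixes F :: "'a::real_normed_vector \<Rightarrow> complex"
  assumes "open V" "z \<in> V" "F differentiable at z" "\<And>w. w \<in> V \<Longrightarrow> Im (F w) = 0"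
  shows "Im (frechet_derivative F (at z) u) = 0"
proof -
  have "((\<lambda>w. Im (F w)) has_derivative (\<lambda>v. Im (frechet_derivative F (at z) v))) (at z)"
    using assms(3) by (intro has_derivative_Im) (simp add: frechet_derivative_works)
  then have "((\<lambda>w. 0) has_derivative (\<lambda>v. Im (frechet_derivative F (at z) v))) (at z)"
    by (rule has_derivative_transform_within_open) (use assms in auto)
  then have "(\<lambda>v. Im (frechet_derivative F (at z) v)) = (\<lambda>v. 0)"
    using has_derivative_const has_derivative_unique by blast
  then show ?thesis by metis
qed

text \<open>Up to the factor 4 the contracted complex Hessian is the sum of the second derivatives in the
  real directions \<open>w\<close> and \<open>\<i> w\<close>, plus \<open>\<i>\<close> times a commutator.  For a real-valued function the
  commutator term is purely imaginary, so the symmetry of second derivatives is not needed.\<close>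

lemma complex_hessian_at_min:
  fixes F :: "complex^'n::finite \<Rightarrow> complex"
  assumes V: "open V" "z \<in> V" and F: "smooth_on F V"
    and real: "\<And>w. w \<in> V \<Longrightarrow> Im (F w) = 0"
    and le: "\<And>w. w \<in> V \<Longrightarrow> Re (F z) \<le> Re (F w)"
  shows "0 \<le> Re (\<Sum>i\<in>UNIV. \<Sum>j\<in>UNIV. w $ i * cnj (w $ j) * dzbar j (dz i F) z)"
proof -
  define D where "D u x = frechet_derivative F (at x) u" for u x
  define D2 where "D2 v u = frechet_derivative (D u) (at z) v" for v u
  have Ddiff: "D u differentiable at x" if "x \<in> V" for u x
    using smooth_on_differentiable[OF smooth_on_frechet[OF F] that] by (simp add: D_def[abs_def])
  have dzd: "dz i F differentiable at x" if "x \<in> V" for i x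
    using smooth_on_differentiable[OF smooth_on_dz[OF V(1) F] that] .
  have wdz: "(\<Sum>i\<in>UNIV. w $ i * dz i F x) = (D w x - \<i> * D (\<i> *s w) x) / 2" if "x \<in> V" for x
    using dz_dzbar_direction(1)[OF smooth_on_differentiable[OF F that]] by (simp add: D_def)
  have "(\<Sum>i\<in>UNIV. \<Sum>j\<in>UNIV. w $ i * cnj (w $ j) * dzbar j (dz i F) z)
      = (\<Sum>j\<in>UNIV. cnj (w $ j) * (\<Sum>i\<in>UNIV. w $ i * dzbar j (dz i F) z))"
    by (subst sum.swap) (simp add: sum_distrib_left mult_ac)
  also have "\<dots> = (\<Sum>j\<in>UNIV. cnj (w $ j) * dzbar j (\<lambda>x. (D w x - \<i> * D (\<i> *s w) x) / 2) z)"
  proof (intro sum.cong refl arg_cong2[where f = "(*)"])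
    fix j
    have "(\<Sum>i\<in>UNIV. w $ i * dzbar j (dz i F) z) = dzbar j (\<lambda>x. \<Sum>i\<in>UNIV. w $ i * dz i F x) z"
      using dzd[OF V(2)] by (subst dz_sum(2)) (auto simp: dz_cmult(2) differentiable_mult)
    also have "\<dots> = dzbar j (\<lambda>x. (D w x - \<i> * D (\<i> *s w) x) / 2) z"
      using dzd[OF V(2)] by (intro dzbar_cong_open[OF V] wdz) (auto intro!: differentiable_sum differentiable_mult)
    finally show "(\<Sum>i\<in>UNIV. w $ i * dzbar j (dz i F) z) = dzbar j (\<lambda>x. (D w x - \<i> * D (\<i> *s w) x) / 2) z" .
  qed
  also have "\<dots> = ((D2 w w - \<i> * D2 w (\<i> *s w)) / 2 + \<i> * ((D2 (\<i> *s w) w - \<i> * D2 (\<i> *s w) (\<i> *s w)) / 2)) / 2"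
  proof -
    have hd: "((\<lambda>x. (D w x - \<i> * D (\<i> *s w) x) / 2) has_derivative
        (\<lambda>v. (D2 v w - \<i> * D2 v (\<i> *s w)) / 2)) (at z)"
      using Ddiff[OF V(2)] unfolding D2_def
      by (intro bounded_linear.has_derivative[OF bounded_linear_divide] has_derivative_diff
          has_derivative_mult_right) (auto simp: frechet_derivative_works)
    show ?thesis
      using hd by (subst dz_dzbar_direction(2)) (auto simp: differentiable_def simp flip: frechet_derivative_at[OF hd])
  qed
  finally have eq: "(\<Sum>i\<in>UNIV. \<Sum>j\<in>UNIV. w $ i * cnj (w $ j) * dzbar j (dz i F) z) = \<dots>" .
  have "Im (D u x) = 0" if "x \<in> V" for u x
    using Im_frechet_derivative_eq_0[OF V(1) that smooth_on_differentiable[OF F that] real]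
    by (simp add: D_def)
  then have "Im (D2 v u) = 0" for v u
    unfolding D2_def by (intro Im_frechet_derivative_eq_0[OF V Ddiff[OF V(2)]])
  moreover have "0 \<le> Re (D2 u u)" for u
    using second_derivative_at_min[OF V F le] by (simp add: D2_def D_def[abs_def])
  ultimately show ?thesis unfolding eq by simp
qed

section \<open>Positive semidefinite matrices\<close>

lemma herm_cmult:
  "herm H (c *s s) t = c * herm H s t" "herm H s (c *s t) = cnj c * herm H s t"
  by (simp_all add: herm_def sum_distrib_left mult_ac)

lemma herm_axis_axis: "herm H (axis a 1) (axis b 1) = H $ a $ b"
proof -
  have "(\<Sum>c\<in>UNIV. H $ c $ b * axis a 1 $ c) = (\<Sum>c\<in>UNIV. if c = a then H $ a $ b else 0)"
    by (intro sum.cong) (auto simp: axis_def)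
  then show ?thesis by (simp add: herm_axis)
qed

lemma herm_cnj_hermitian:
  assumes "\<And>i j. H $ j $ i = cnj (H $ i $ j)"
  shows "cnj (herm H s t) = herm H t s"
proof -
  have "cnj (herm H s t) = (\<Sum>a\<in>UNIV. \<Sum>b\<in>UNIV. H $ b $ a * t $ b * cnj (s $ a))"
    unfolding herm_def cnj_sum
    by (intro sum.cong refl, subst (2) assms) (simp add: mult_ac)
  also have "\<dots> = herm H t s"
    unfolding herm_def by (rule sum.swap)
  finally show ?thesis .
qed

lemma Re_herm_add_cmult_axis:
  assumes "\<And>i j. G $ j $ i = cnj (G $ i $ j)"
  shows "Re (herm G (s + c *s axis a 1) (s + c *s axis a 1))
      = Re (herm G s s) + 2 * Re (cnj c * herm G s (axis a 1)) + (cmod c)\<^sup>2 * Re (G $ a $ a)"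
proof -
  have "herm G (axis a 1) s = cnj (herm G s (axis a 1))"
    using herm_cnj_hermitian[OF assms] by metis
  moreover have "Im (G $ a $ a) = 0"
    using arg_cong[OF assms[of a a], of Im] by simp
  ultimately show ?thesis
    unfolding cmod_power2
    by (simp add: herm_add herm_cmult herm_axis_axis algebra_simps power2_eq_square)
qed

lemma psd_diag_zero_imp_column_zero:
  assumes G: "\<And>i j. G $ j $ i = cnj (G $ i $ j)" "\<And>s. 0 \<le> Re (herm G s s)"
    and "G $ a $ a = 0"
  shows "G $ i $ a = 0"
proof (rule ccontr)
  assume ne: "G $ i $ a \<noteq> 0"
  \<comment> \<open>Moving from \<open>axis i 1\<close> along \<open>axis a 1\<close> changes the form linearly; \<open>q\<close> is chosen to make it negative.\<close>
  define q where "q = (Re (G $ i $ i) + 1) / (cmod (G $ i $ a))\<^sup>2"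
  define c where "c = - of_real q * G $ i $ a"
  have "Re (cnj c * G $ i $ a) = - q * (cmod (G $ i $ a))\<^sup>2"
    unfolding cmod_power2 by (simp add: c_def power2_eq_square algebra_simps)
  also have "\<dots> = - (Re (G $ i $ i) + 1)"
    using ne by (simp add: q_def)
  finally have "Re (cnj c * G $ i $ a) = - (Re (G $ i $ i) + 1)" .
  moreover have "0 \<le> Re (G $ i $ i) + 2 * Re (cnj c * G $ i $ a)"
    using G(2)[of "axis i 1 + c *s axis a 1"]
    unfolding Re_herm_add_cmult_axis[OF G(1)] herm_axis_axis assms(3) by simp
  moreover have "0 \<le> Re (G $ i $ i)"
    using G(2)[of "axis i 1"] by (simp add: herm_axis_axis)
  ultimately show False by linarith
qed

text \<open>Induction on the index set that supports \<open>G\<close>: subtracting the rank one matrix built from column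
  \<open>a\<close> clears row and column \<open>a\<close>, and the Schur complement that is left is again positive
  semidefinite.\<close>

lemma psd_rank_one_decomposition_supported:
  fixes G :: "complex^'n::finite^'n"
  assumes "finite S" and "\<And>i j. G $ j $ i = cnj (G $ i $ j)" "\<And>s. 0 \<le> Re (herm G s s)"
    and "\<And>i j. i \<notin> S \<Longrightarrow> G $ i $ j = 0"
  shows "\<exists>w :: 'n \<Rightarrow> complex^'n. \<forall>i j. G $ i $ j = (\<Sum>k\<in>S. w k $ i * cnj (w k $ j))"
  using assms
proof (induction S arbitrary: G rule: finite_induct)
  case empty
  then show ?case by simp
next
  case (insert a S)
  note G = insert.prems
  define p where "p = Re (G $ a $ a)"
  have p: "G $ a $ a = of_real p"
    using arg_cong[OF G(1)[of a a], of Im] by (simp add: p_def complex_eq_iff)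
  have "p \<ge> 0" using G(2)[of "axis a 1"] by (simp add: herm_axis_axis p_def)
  \<comment> \<open>If \<open>p = 0\<close> then \<open>u = 0\<close>, as division by zero gives zero; column \<open>a\<close> of \<open>G\<close> vanishes in that case.\<close>
  define u :: "complex^'n" where "u = (\<chi> i. G $ i $ a / of_real (sqrt p))"
  define G' :: "complex^'n^'n" where "G' = (\<chi> i j. G $ i $ j - u $ i * cnj (u $ j))"
  have uu: "p * (u $ i * cnj (u $ j)) = G $ i $ a * cnj (G $ j $ a)" for i j
  proof (cases "p = 0")
    case True
    then have "G $ i $ a = 0"
      using psd_diag_zero_imp_column_zero[OF G(1,2)] p by simp
    with True show ?thesis by simp
  next
    case False
    then show ?thesis using \<open>p \<ge> 0\<close>
      by (simp add: u_def field_simps power2_eq_square flip: of_real_mult)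
  qed
  have G'1: "G' $ j $ i = cnj (G' $ i $ j)" for i j
    using G(1)[of i j] by (simp add: G'_def)
  have hG': "herm G' s s = herm G s s - of_real ((cmod (\<Sum>i\<in>UNIV. u $ i * s $ i))\<^sup>2)" for s
  proof -
    have "(\<Sum>i\<in>UNIV. \<Sum>j\<in>UNIV. u $ i * cnj (u $ j) * s $ i * cnj (s $ j))
       = (\<Sum>i\<in>UNIV. u $ i * s $ i) * cnj (\<Sum>i\<in>UNIV. u $ i * s $ i)"
      by (simp add: sum_product mult_ac)
    then show ?thesis
      unfolding complex_norm_square
      by (simp add: herm_def G'_def algebra_simps sum_subtractf)
  qed
  have G'2: "0 \<le> Re (herm G' s s)" for s
  proof (cases "p = 0")
    case True
    then have "u = 0" by (simp add: u_def vec_eq_iff)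
    then show ?thesis using G(2)[of s] by (simp add: hG')
  next
    case False
    define m where "m = herm G s (axis a 1)"
    have m: "(\<Sum>i\<in>UNIV. u $ i * s $ i) = m / of_real (sqrt p)"
      by (simp add: m_def herm_axis u_def sum_divide_distrib)
    \<comment> \<open>The multiple of \<open>axis a 1\<close> added to \<open>s\<close> minimizes the form of \<open>G\<close>.\<close>
    have "0 \<le> Re (herm G s s) + 2 * Re (cnj (- m / of_real p) * m) + (cmod (- m / of_real p))\<^sup>2 * p"
      using G(2)[of "s + (- m / of_real p) *s axis a 1"]
      unfolding Re_herm_add_cmult_axis[OF G(1)] m_def[symmetric] p_def[symmetric] .
    also have "Re (cnj (- m / of_real p) * m) = - (cmod m)\<^sup>2 / p"
      unfolding cmod_power2 by (simp add: Re_divide_of_real power2_eq_square add_divide_distrib diff_divide_distrib)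
    also have "(cmod (- m / of_real p))\<^sup>2 * p = (cmod m)\<^sup>2 / p"
      using False \<open>p \<ge> 0\<close> by (simp add: norm_divide power_divide power2_eq_square)
    finally have "(cmod m)\<^sup>2 / p \<le> Re (herm G s s)" by simp
    moreover have "(cmod (m / of_real (sqrt p)))\<^sup>2 = (cmod m)\<^sup>2 / p"
      using \<open>p \<ge> 0\<close> by (simp add: norm_divide power_divide)
    ultimately show ?thesis unfolding hG' m by simp
  qed
  have G'3: "G' $ i $ j = 0" if "i \<notin> S" for i j
  proof (cases "p = 0")
    case True
    have "G $ i $ j = 0"
    proof (cases "i = a")
      case True
      then show ?thesis
        using psd_diag_zero_imp_column_zero[OF G(1,2), of a j] \<open>p = 0\<close> p G(1)[of j i] by simp
    next
      case False
      then show ?thesis using G(3)[of i j] that by simp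
    qed
    with True show ?thesis by (simp add: G'_def u_def)
  next
    case False
    have "of_real p * G' $ i $ j = of_real p * G $ i $ j - G $ i $ a * cnj (G $ j $ a)"
      using uu[of i j] by (simp add: G'_def algebra_simps)
    also have "\<dots> = 0"
    proof (cases "i = a")
      case True
      then show ?thesis using p G(1)[of j a] by simp
    next
      case False
      then show ?thesis using G(3)[of i] that by simp
    qed
    finally show ?thesis using False by simp
  qed
  obtain w where w: "\<And>i j. G' $ i $ j = (\<Sum>k\<in>S. w k $ i * cnj (w k $ j))"
    using insert.IH[OF G'1 G'2 G'3] by metis
  have "G $ i $ j = (\<Sum>k\<in>insert a S. (w(a := u)) k $ i * cnj ((w(a := u)) k $ j))" for i j
  proof -
    have "(\<Sum>k\<in>S. (w(a := u)) k $ i * cnj ((w(a := u)) k $ j)) = G' $ i $ j"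
      unfolding w using insert.hyps by (intro sum.cong) auto
    then show ?thesis using insert.hyps by (simp add: G'_def)
  qed
  then show ?case by blast
qed

lemma psd_rank_one_decomposition:
  fixes G :: "complex^'n::finite^'n"
  assumes "\<And>i j. G $ j $ i = cnj (G $ i $ j)" "\<And>s. 0 \<le> Re (herm G s s)"
  shows "\<exists>w :: 'n \<Rightarrow> complex^'n. \<forall>i j. G $ i $ j = (\<Sum>k\<in>UNIV. w k $ i * cnj (w k $ j))"
  using psd_rank_one_decomposition_supported[OF finite_class.finite_UNIV assms] by simp

text \<open>The transpose is the matrix \<open>g\<^sup>i\<^sup>j\<close>, normalized by \<open>g\<^sup>i\<^sup>j g\<^sub>k\<^sub>j = \<delta>\<^sup>i\<^sub>k\<close>.\<close>

lemma inverse_metric_psd: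
  fixes g :: "complex^'n::finite^'n"
  assumes g: "hermitian_pos_def g"
  defines "G \<equiv> transpose (matrix_inv g)"
  shows "G $ j $ i = cnj (G $ i $ j)" "0 \<le> Re (herm G s s)"
proof -
  have inv: "invertible g"
    using hermitian_pos_def_det[OF g] by (simp add: invertible_det_nz)
  have ginv: "g ** matrix_inv g = mat 1"
    using someI_ex[OF inv[unfolded invertible_def]] by (simp add: matrix_inv_def)
  have gu: "g *v (matrix_inv g *v v) = v" for v
    by (simp add: matrix_vector_mul_assoc ginv)
  define bar :: "complex^'n \<Rightarrow> complex^'n" where "bar v = (\<chi> i. cnj (v $ i))" for v
  have key: "herm G v w = herm g (bar (matrix_inv g *v w)) (bar (matrix_inv g *v v))" for v w
  proof -
    define u t where "u = matrix_inv g *v v" and "t = matrix_inv g *v w"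
    have w: "cnj (w $ j) = (\<Sum>k\<in>UNIV. g $ k $ j * cnj (t $ k))" for j
    proof -
      have "w $ j = (\<Sum>k\<in>UNIV. g $ j $ k * t $ k)"
        using arg_cong[OF gu[of w], of "\<lambda>v. v $ j"] unfolding t_def[symmetric]
        by (simp add: matrix_vector_mult_def)
      moreover have "cnj (g $ j $ k) = g $ k $ j" for k
        using g unfolding hermitian_pos_def_def by metis
      ultimately show ?thesis by (simp add: cnj_sum)
    qed
    have "herm G v w = (\<Sum>j\<in>UNIV. u $ j * cnj (w $ j))"
      unfolding herm_def G_def u_def transpose_def matrix_vector_mult_def
      by (subst sum.swap) (simp add: sum_distrib_right)
    also have "\<dots> = (\<Sum>k\<in>UNIV. \<Sum>j\<in>UNIV. g $ k $ j * cnj (t $ k) * u $ j)"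
      unfolding w by (subst sum.swap) (simp add: sum_distrib_left mult_ac)
    finally show ?thesis by (simp add: herm_def bar_def u_def t_def)
  qed
  have "herm G (axis j 1) (axis i 1) = cnj (herm G (axis i 1) (axis j 1))"
    unfolding key by (simp add: herm_cnj[OF g])
  then show "G $ j $ i = cnj (G $ i $ j)"
    by (simp only: herm_axis_axis)
  have "0 \<le> Re (herm g v v)" for v
  proof (cases "v = 0")
    case False
    then have "0 < Re (herm g v v)"
      using g unfolding hermitian_pos_def_def by blast
    then show ?thesis by simp
  qed (simp add: herm_def)
  then show "0 \<le> Re (herm G s s)"
    by (simp add: key)
qed

section \<open>The complex Hessian of the squared norm of a holomorphic section\<close>

text \<open>In a holomorphic frame the curvature of the Chern connection is the Dolbeault derivative of its
  connection form \<open>P\<^sub>i dz\<^sup>i\<close>; the sign comes from ordering \<open>dz\<^sup>i\<close> before \<open>d(cnj z\<^sup>j)\<close>.\<close>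

lemma curvature_eq_dzbar:
  fixes V :: "(complex^'n::finite) set" and H :: "complex^'n \<Rightarrow> complex^'r::finite^'r"
  defines "P \<equiv> fst (chern_connection V H)"
  assumes V: "open V" "z \<in> V" and H: "\<And>\<alpha> \<beta>. smooth_on (\<lambda>z. H z $ \<alpha> $ \<beta>) V"
    and pos: "\<And>z. z \<in> V \<Longrightarrow> hermitian_pos_def (H z)"
  shows "curvature V H i j z $ \<gamma> $ \<alpha> = - dzbar j (\<lambda>w. P i w $ \<gamma> $ \<alpha>) z"
proof -
  define Q where "Q = snd (chern_connection V H)"
  have ch: "is_chern_connection V H P Q"
    unfolding P_def Q_def using V(1) H pos by (rule chern_connection_exists)
  have Pe: "nabla P i (\<lambda>_. axis \<alpha> 1) w $ \<gamma> = P i w $ \<gamma> $ \<alpha>" for w \<gamma>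
    by (simp add: nabla_def dz_const matrix_mult_axis)
  have smP: "smooth_on (\<lambda>w. P i w $ \<gamma> $ \<alpha>) V" for \<gamma>
    using ch unfolding is_chern_connection_def by blast
  have "smooth_on (nabla P i (\<lambda>_. axis \<alpha> 1)) V"
    by (intro smooth_on_vec V) (simp add: Pe smP)
  then have 1: "nablabar Q j (nabla P i (\<lambda>_. axis \<alpha> 1)) z = (\<chi> \<gamma>. dzbar j (\<lambda>w. P i w $ \<gamma> $ \<alpha>) z)"
    using ch V(2) unfolding is_chern_connection_def Pe[symmetric] by blast
  have 2: "nablabar Q j (\<lambda>_. axis \<alpha> 1) w = 0" if "w \<in> V" for w
  proof -
    have "nablabar Q j (\<lambda>_. axis \<alpha> 1) w = (\<chi> \<gamma>. dzbar j (\<lambda>w. axis \<alpha> (1::complex) $ \<gamma>) w)"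
      using ch that smooth_on_const[of "axis \<alpha> (1::complex)" V]
      unfolding is_chern_connection_def by blast
    then show ?thesis by (simp add: vec_eq_iff dzbar_const)
  qed
  have "dz i (\<lambda>w. nablabar Q j (\<lambda>_. axis \<alpha> 1) w $ \<gamma>) z = dz i (\<lambda>w. 0) z" for \<gamma>
    by (rule dz_cong_open[OF V, symmetric]) (simp_all add: 2)
  then have "nabla P i (nablabar Q j (\<lambda>_. axis \<alpha> 1)) z = 0"
    by (simp add: nabla_def dz_const 2[OF V(2)] zero_vec_def[symmetric])
  with 1 show ?thesis
    by (simp add: curvature_def P_def[symmetric] Q_def[symmetric])
qed

lemma herm_lowered_curvature:
  "herm (lowered_curvature V H i j z) s t = herm (H z) (curvature V H i j z *v s) t"
proof -
  have "herm (lowered_curvature V H i j z) s t = (\<Sum>\<beta>\<in>UNIV. \<Sum>\<alpha>\<in>UNIV. \<Sum>\<gamma>\<in>UNIV.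
      H z $ \<gamma> $ \<beta> * curvature V H i j z $ \<gamma> $ \<alpha> * s $ \<alpha> * cnj (t $ \<beta>))"
    unfolding herm_def lowered_curvature_def
    by (subst sum.swap) (simp add: sum_distrib_right)
  also have "\<dots> = (\<Sum>\<beta>\<in>UNIV. \<Sum>\<gamma>\<in>UNIV. \<Sum>\<alpha>\<in>UNIV.
      H z $ \<gamma> $ \<beta> * curvature V H i j z $ \<gamma> $ \<alpha> * s $ \<alpha> * cnj (t $ \<beta>))"
    by (intro sum.cong refl sum.swap)
  also have "\<dots> = herm (H z) (curvature V H i j z *v s) t"
    unfolding herm_def matrix_vector_mult_def
    by (subst (2) sum.swap) (simp add: sum_distrib_left sum_distrib_right mult_ac)
  finally show ?thesis .
qed

text \<open>The local holomorphic section whose coordinates in the frame are affine in \<open>z\<close>, with value \<open>a\<close> and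
  derivatives \<open>b i\<close> at \<open>z0\<close>.\<close>

definition affine_section ::
  "complex^'n \<Rightarrow> complex^'r \<Rightarrow> ('n \<Rightarrow> complex^'r) \<Rightarrow> complex^'n::finite \<Rightarrow> complex^'r::finite" where
  "affine_section z0 a b z = a + (\<Sum>i\<in>UNIV. (z $ i - z0 $ i) *s b i)"

lemma affine_section_at [simp]: "affine_section z0 a b z0 = a"
  by (simp add: affine_section_def)

lemma affine_section_has_derivative:
  "((\<lambda>w. affine_section z0 a b w $ \<gamma>) has_derivative (\<lambda>v. \<Sum>i\<in>UNIV. v $ i * b i $ \<gamma>)) (at z)"
  unfolding affine_section_def
  by (auto intro!: derivative_eq_intros bounded_linear.has_derivative[OF bounded_linear_vec_nth])

lemma dz_affine_section:
  "dz i (\<lambda>w. affine_section z0 a b w $ \<gamma>) z = b i $ \<gamma>"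
  "dzbar i (\<lambda>w. affine_section z0 a b w $ \<gamma>) z = 0"
proof -
  have "(\<Sum>k\<in>UNIV. axis i c $ k * b k $ \<gamma>) = (\<Sum>k\<in>UNIV. if k = i then c * b i $ \<gamma> else 0)" for c :: complex
    by (intro sum.cong) (auto simp: axis_def)
  then have "frechet_derivative (\<lambda>w. affine_section z0 a b w $ \<gamma>) (at z) (axis i c) = c * b i $ \<gamma>" for c
    by (simp flip: frechet_derivative_at[OF affine_section_has_derivative])
  then show "dz i (\<lambda>w. affine_section z0 a b w $ \<gamma>) z = b i $ \<gamma>"
    "dzbar i (\<lambda>w. affine_section z0 a b w $ \<gamma>) z = 0"
    by (simp_all add: dz_def dzbar_def)
qed

lemma smooth_on_affine_section:
  assumes "open V"
  shows "smooth_on (affine_section z0 a b) V"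
proof (rule smooth_on_vec[OF assms])
  fix \<gamma>
  have "smooth_on (\<lambda>w :: complex^'a. a $ \<gamma> + (\<Sum>i\<in>UNIV. (w $ i + - z0 $ i) * b i $ \<gamma>)) V"
    using assms
    by (intro smooth_on_add smooth_on_sum smooth_on_mult smooth_on_const
        smooth_on_bounded_linear bounded_linear_vec_nth finite_class.finite_UNIV)
  then show "smooth_on (\<lambda>z. affine_section z0 a b z $ \<gamma>) V"
    by (simp add: affine_section_def left_diff_distrib)
qed

lemma smooth_on_herm:
  assumes "open V" "\<And>\<alpha> \<beta>. smooth_on (\<lambda>z. H z $ \<alpha> $ \<beta>) V" "smooth_on s V" "smooth_on t V"
  shows "smooth_on (\<lambda>z. herm (H z) (s z) (t z)) V"
  unfolding herm_def using assms
  by (intro smooth_on_sum smooth_on_mult finite_class.finite_UNIV)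
    (auto intro: smooth_on_bounded_linear_compose[OF _ bounded_linear_vec_nth]
      smooth_on_bounded_linear_compose[OF _ bounded_linear_cnj]
      smooth_on_bounded_linear_compose[OF _ bounded_linear_compose[OF bounded_linear_cnj bounded_linear_vec_nth]])

text \<open>The Bochner formula for a holomorphic section: the complex Hessian of \<open>H(s, s)\<close> is
  \<open>H(\<nabla>\<^sub>i s, \<nabla>\<^sub>j s) - R\<^sub>i\<^sub>j(s, s)\<close>.\<close>

lemma complex_hessian_herm_affine_section:
  fixes V :: "(complex^'n::finite) set" and H :: "complex^'n \<Rightarrow> complex^'r::finite^'r"
  defines "P \<equiv> fst (chern_connection V H)"
  assumes V: "open V" "z0 \<in> V" and H: "\<And>\<alpha> \<beta>. smooth_on (\<lambda>z. H z $ \<alpha> $ \<beta>) V"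
    and pos: "\<And>z. z \<in> V \<Longrightarrow> hermitian_pos_def (H z)"
  shows "dzbar j (dz i (\<lambda>z. herm (H z) (affine_section z0 a b z) (affine_section z0 a b z))) z0
    = herm (H z0) (b i + P i z0 *v a) (b j + P j z0 *v a)
      - herm (lowered_curvature V H i j z0) a a"
proof -
  define s where "s = affine_section z0 a b"
  define Q where "Q = snd (chern_connection V H)"
  have ch: "is_chern_connection V H P Q"
    unfolding P_def Q_def using V(1) H pos by (rule chern_connection_exists)
  have s: "smooth_on s V"
    unfolding s_def using V(1) by (rule smooth_on_affine_section)
  have smP: "smooth_on (\<lambda>w. P i w $ \<gamma> $ \<alpha>) V" for i \<gamma> \<alpha>
    using ch unfolding is_chern_connection_def by blast
  have nb: "nablabar Q k u z = (\<chi> \<gamma>. dzbar k (\<lambda>w. u w $ \<gamma>) z)" if "smooth_on u V" "z \<in> V" for u k z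
    using ch that unfolding is_chern_connection_def by blast
  have nbs: "nablabar Q k s z = 0" if "z \<in> V" for k z
    unfolding nb[OF s that] by (simp add: s_def dz_affine_section vec_eq_iff)
  have sg: "smooth_on (\<lambda>w. s w $ \<gamma>) V" for \<gamma>
    using smooth_on_bounded_linear_compose[OF V(1) bounded_linear_vec_nth s] .
  have ns: "nabla P k s z $ \<gamma> = b k $ \<gamma> + (\<Sum>\<alpha>\<in>UNIV. P k z $ \<gamma> $ \<alpha> * s z $ \<alpha>)" for k z \<gamma>
    by (simp add: nabla_def s_def dz_affine_section matrix_vector_mult_def)
  have sns: "smooth_on (nabla P k s) V" for k
    unfolding ns using V(1) smP sg
    by (intro smooth_on_vec) (auto simp: ns intro!: smooth_on_add smooth_on_sum smooth_on_mult smooth_on_const)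
  have first: "dz i (\<lambda>w. herm (H w) (s w) (s w)) z = herm (H z) (nabla P i s z) (s z)" if "z \<in> V" for z
    using ch s that nbs[OF that] unfolding is_chern_connection_def by (simp add: herm_def)
  have nbns: "nablabar Q j (nabla P i s) z0 = - (curvature V H i j z0 *v a)"
  proof -
    have "dzbar j (\<lambda>w. nabla P i s w $ \<gamma>) z0 = (\<Sum>\<alpha>\<in>UNIV. dzbar j (\<lambda>w. P i w $ \<gamma> $ \<alpha>) z0 * a $ \<alpha>)" for \<gamma>
    proof -
      have d: "(\<lambda>w. P i w $ \<gamma> $ \<alpha>) differentiable at z0" "(\<lambda>w. s w $ \<alpha>) differentiable at z0" for \<alpha>
        using smooth_on_differentiable[OF smP V(2)] smooth_on_differentiable[OF sg V(2)] by auto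
      have "dzbar j (\<lambda>w. nabla P i s w $ \<gamma>) z0
          = dzbar j (\<lambda>w. (\<Sum>\<alpha>\<in>UNIV. P i w $ \<gamma> $ \<alpha> * s w $ \<alpha>) - (- b i $ \<gamma>)) z0"
        by (simp add: ns add.commute)
      also have "\<dots> = dzbar j (\<lambda>w. \<Sum>\<alpha>\<in>UNIV. P i w $ \<gamma> $ \<alpha> * s w $ \<alpha>) z0"
        using d by (subst dz_diff(2)) (auto simp: dzbar_const intro!: differentiable_sum differentiable_mult)
      also have "\<dots> = (\<Sum>\<alpha>\<in>UNIV. dzbar j (\<lambda>w. P i w $ \<gamma> $ \<alpha>) z0 * s z0 $ \<alpha>
          + P i z0 $ \<gamma> $ \<alpha> * dzbar j (\<lambda>w. s w $ \<alpha>) z0)"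
        using d by (subst dz_sum(2)) (auto simp: dz_mult(2) intro!: differentiable_mult)
      finally show ?thesis by (simp add: s_def dz_affine_section)
    qed
    then show ?thesis
      unfolding nb[OF sns V(2)]
      by (simp add: vec_eq_iff matrix_vector_mult_def sum_negf
          curvature_eq_dzbar[OF V H pos] P_def)
  qed
  have "dzbar j (dz i (\<lambda>w. herm (H w) (s w) (s w))) z0 = dzbar j (\<lambda>z. herm (H z) (nabla P i s z) (s z)) z0"
    using V smooth_on_dz[OF V(1) smooth_on_herm[OF V(1) H s s]]
    by (intro dzbar_cong_open[OF V] smooth_on_differentiable first) auto
  also have "\<dots> = herm (H z0) (nablabar Q j (nabla P i s) z0) (s z0)
      + herm (H z0) (nabla P i s z0) (nabla P j s z0)"
    using ch s sns V(2) unfolding is_chern_connection_def by blast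
  also have "\<dots> = herm (H z0) (b i + P i z0 *v a) (b j + P j z0 *v a)
      - herm (lowered_curvature V H i j z0) a a"
  proof -
    have "nabla P k s z0 = b k + P k z0 *v a" for k
      by (simp add: vec_eq_iff ns matrix_vector_mult_def) (simp add: s_def)
    moreover have "herm (H z0) (- u) a = - herm (H z0) u a" for u
      by (simp add: herm_def sum_negf)
    ultimately show ?thesis
      unfolding nbns herm_lowered_curvature by (simp add: s_def)
  qed
  finally show ?thesis
    unfolding s_def .
qed

section \<open>The pointwise comparison at a maximum of the ratio of two metrics\<close>

lemma herm_sum:
  "herm H (\<Sum>i\<in>I. x i) t = (\<Sum>i\<in>I. herm H (x i) t)"
  "herm H s (\<Sum>i\<in>I. x i) = (\<Sum>i\<in>I. herm H s (x i))"
  by (induction I rule: infinite_finite_induct) (simp_all add: herm_add, simp_all add: herm_def)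

lemma hermitian_pos_def_herm_nonneg:
  assumes "hermitian_pos_def H"
  shows "0 \<le> Re (herm H s s)"
proof (cases "s = 0")
  case False
  then show ?thesis
    using assms less_imp_le unfolding hermitian_pos_def_def by blast
qed (simp add: herm_def)

lemma trace_herm_nonneg:
  assumes G: "\<And>i j. G $ i $ j = (\<Sum>k\<in>UNIV. w k $ i * cnj (w k $ j))"
    and H: "hermitian_pos_def H"
  shows "0 \<le> Re (\<Sum>i\<in>UNIV. \<Sum>j\<in>UNIV. G $ i $ j * herm H (x i) (x j))"
proof -
  have "(\<Sum>i\<in>UNIV. \<Sum>j\<in>UNIV. G $ i $ j * herm H (x i) (x j))
      = (\<Sum>i\<in>UNIV. \<Sum>j\<in>UNIV. \<Sum>k\<in>UNIV. herm H (w k $ i *s x i) (w k $ j *s x j))"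
    by (simp add: G herm_cmult sum_distrib_left sum_distrib_right mult_ac)
  also have "\<dots> = (\<Sum>i\<in>UNIV. \<Sum>k\<in>UNIV. \<Sum>j\<in>UNIV. herm H (w k $ i *s x i) (w k $ j *s x j))"
    by (intro sum.cong refl sum.swap)
  also have "\<dots> = (\<Sum>k\<in>UNIV. \<Sum>i\<in>UNIV. \<Sum>j\<in>UNIV. herm H (w k $ i *s x i) (w k $ j *s x j))"
    by (rule sum.swap)
  also have "\<dots> = (\<Sum>k\<in>UNIV. herm H (\<Sum>i\<in>UNIV. w k $ i *s x i) (\<Sum>j\<in>UNIV. w k $ j *s x j))"
    by (simp only: herm_sum(1)) (simp only: herm_sum(2))
  finally show ?thesis
    using hermitian_pos_def_herm_nonneg[OF H] by (simp add: sum_nonneg)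
qed

text \<open>The affine section \<open>s\<close> is made parallel for \<open>H0\<close> at \<open>z0\<close>.  The function
  \<open>lam H0(s, s) - H(s, s)\<close> has its minimum 0 at \<open>z0\<close>, and the trace with \<open>G\<close> of its complex Hessian is
  the trace of \<open>R - lam R0\<close> minus the trace of \<open>H(\<nabla>\<^sub>i s, \<nabla>\<^sub>j s)\<close>, which is nonnegative.\<close>

lemma curvature_comparison_at_min:
  fixes V :: "(complex^'n::finite) set" and H H0 :: "complex^'n \<Rightarrow> complex^'r::finite^'r"
    and lam :: real
  assumes V: "open V" "z0 \<in> V"
    and H: "\<And>\<alpha> \<beta>. smooth_on (\<lambda>z. H z $ \<alpha> $ \<beta>) V" "\<And>z. z \<in> V \<Longrightarrow> hermitian_pos_def (H z)"
    and H0: "\<And>\<alpha> \<beta>. smooth_on (\<lambda>z. H0 z $ \<alpha> $ \<beta>) V" "\<And>z. z \<in> V \<Longrightarrow> hermitian_pos_def (H0 z)"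
    and le: "\<And>z s. z \<in> V \<Longrightarrow> Re (herm (H z) s s) \<le> lam * Re (herm (H0 z) s s)"
    and eq: "Re (herm (H z0) a a) = lam * Re (herm (H0 z0) a a)"
    and G: "\<And>i j. G $ j $ i = cnj (G $ i $ j)" "\<And>s. 0 \<le> Re (herm G s s)"
  shows "lam * Re (\<Sum>i\<in>UNIV. \<Sum>j\<in>UNIV. G $ i $ j * herm (lowered_curvature V H0 i j z0) a a)
    \<le> Re (\<Sum>i\<in>UNIV. \<Sum>j\<in>UNIV. G $ i $ j * herm (lowered_curvature V H i j z0) a a)"
proof -
  obtain w :: "'n \<Rightarrow> complex^'n"
    where w': "\<forall>i j. G $ i $ j = (\<Sum>k\<in>UNIV. w k $ i * cnj (w k $ j))"
    using exE[OF psd_rank_one_decomposition[OF G]] .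
  then have w: "G $ i $ j = (\<Sum>k\<in>UNIV. w k $ i * cnj (w k $ j))" for i j
    by simp
  define P0 where "P0 = fst (chern_connection V H0)"
  define P where "P = fst (chern_connection V H)"
  \<comment> \<open>This choice of \<open>b\<close> makes the covariant derivatives of \<open>s\<close> with respect to \<open>H0\<close> vanish at \<open>z0\<close>.\<close>
  define b where "b i = - (P0 i z0 *v a)" for i
  define s where "s = affine_section z0 a b"
  define f f0 where "f z = herm (H z) (s z) (s z)" and "f0 z = herm (H0 z) (s z) (s z)" for z
  define F where "F z = of_real lam * f0 z - f z" for z
  have ss: "smooth_on s V"
    unfolding s_def using V(1) by (rule smooth_on_affine_section)
  have f: "smooth_on f V" and f0: "smooth_on f0 V"
    unfolding f_def[abs_def] f0_def[abs_def]
    by (rule smooth_on_herm[OF V(1) H(1) ss ss], rule smooth_on_herm[OF V(1) H0(1) ss ss])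
  have F: "smooth_on F V"
  proof -
    have "smooth_on (\<lambda>z. of_real lam * f0 z + (-1) * f z) V"
      using V(1) f f0 by (intro smooth_on_add smooth_on_mult smooth_on_const)
    then show ?thesis by (simp add: F_def[abs_def])
  qed
  have real: "Im (F z) = 0" if "z \<in> V" for z
  proof -
    have "Im (herm (M z) (s z) (s z)) = 0" if "hermitian_pos_def (M z)" for M :: "complex^'n \<Rightarrow> complex^'r^'r"
      using arg_cong[OF herm_cnj[OF that, of "s z" "s z"], of Im] by simp
    then show ?thesis using H(2)[OF that] H0(2)[OF that] by (simp add: F_def f_def f0_def)
  qed
  have "Re (F z0) \<le> Re (F z)" if "z \<in> V" for z
    using le[OF that, of "s z"] eq by (simp add: F_def f_def f0_def s_def)
  note hess = complex_hessian_at_min[OF V F real this]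
  have dF: "dzbar j (dz i F) z0 = of_real lam * dzbar j (dz i f0) z0 - dzbar j (dz i f) z0" for i j
  proof -
    note d = smooth_on_differentiable[OF smooth_on_dz[OF V(1) f] V(2), of i]
      smooth_on_differentiable[OF smooth_on_dz[OF V(1) f0] V(2), of i]
    have "dz i F z = of_real lam * dz i f0 z - dz i f z" if "z \<in> V" for z
      using smooth_on_differentiable[OF f that] smooth_on_differentiable[OF f0 that]
      unfolding F_def[abs_def] by (simp add: dz_diff dz_cmult differentiable_mult)
    then have "dzbar j (dz i F) z0 = dzbar j (\<lambda>z. of_real lam * dz i f0 z - dz i f z) z0"
      by (rule dzbar_cong_open[OF V smooth_on_differentiable[OF smooth_on_dz[OF V(1) F] V(2)]])
    also have "\<dots> = of_real lam * dzbar j (dz i f0) z0 - dzbar j (dz i f) z0"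
      using d by (simp add: dz_diff dz_cmult differentiable_mult)
    finally show ?thesis .
  qed
  define R R0 x where "R i j = herm (lowered_curvature V H i j z0) a a"
    and "R0 i j = herm (lowered_curvature V H0 i j z0) a a"
    and "x i = b i + P i z0 *v a" for i j
  have d0: "dzbar j (dz i f0) z0 = - R0 i j" for i j
    unfolding f0_def[abs_def] s_def R0_def
    by (simp only: complex_hessian_herm_affine_section[OF V H0]) (simp add: b_def P0_def herm_def)
  have d: "dzbar j (dz i f) z0 = herm (H z0) (x i) (x j) - R i j" for i j
    unfolding f_def[abs_def] s_def R_def x_def P_def
    by (rule complex_hessian_herm_affine_section[OF V H])
  have "0 \<le> (\<Sum>k\<in>UNIV. Re (\<Sum>i\<in>UNIV. \<Sum>j\<in>UNIV. w k $ i * cnj (w k $ j) * dzbar j (dz i F) z0))"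
    by (intro sum_nonneg hess)
  also have "\<dots> = Re (\<Sum>i\<in>UNIV. \<Sum>j\<in>UNIV. G $ i $ j * dzbar j (dz i F) z0)"
  proof -
    have "(\<Sum>k\<in>UNIV. \<Sum>i\<in>UNIV. \<Sum>j\<in>UNIV. w k $ i * cnj (w k $ j) * dzbar j (dz i F) z0)
        = (\<Sum>i\<in>UNIV. \<Sum>k\<in>UNIV. \<Sum>j\<in>UNIV. w k $ i * cnj (w k $ j) * dzbar j (dz i F) z0)"
      by (rule sum.swap)
    also have "\<dots> = (\<Sum>i\<in>UNIV. \<Sum>j\<in>UNIV. \<Sum>k\<in>UNIV. w k $ i * cnj (w k $ j) * dzbar j (dz i F) z0)"
      by (intro sum.cong refl sum.swap)
    also have "\<dots> = (\<Sum>i\<in>UNIV. \<Sum>j\<in>UNIV. G $ i $ j * dzbar j (dz i F) z0)"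
      unfolding w sum_distrib_right ..
    finally show ?thesis by (simp only: Re_sum[symmetric])
  qed
  also have "\<dots> = Re (\<Sum>i\<in>UNIV. \<Sum>j\<in>UNIV. G $ i $ j * R i j)
      - lam * Re (\<Sum>i\<in>UNIV. \<Sum>j\<in>UNIV. G $ i $ j * R0 i j)
      - Re (\<Sum>i\<in>UNIV. \<Sum>j\<in>UNIV. G $ i $ j * herm (H z0) (x i) (x j))"
  proof -
    have "(\<Sum>i\<in>UNIV. \<Sum>j\<in>UNIV. G $ i $ j * dzbar j (dz i F) z0)
      = (\<Sum>i\<in>UNIV. \<Sum>j\<in>UNIV. G $ i $ j * R i j)
      - of_real lam * (\<Sum>i\<in>UNIV. \<Sum>j\<in>UNIV. G $ i $ j * R0 i j)
      - (\<Sum>i\<in>UNIV. \<Sum>j\<in>UNIV. G $ i $ j * herm (H z0) (x i) (x j))"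
      unfolding dF d d0 by (simp add: algebra_simps sum_subtractf sum_distrib_left sum.distrib sum_negf)
    then show ?thesis by simp
  qed
  also have "\<dots> \<le> Re (\<Sum>i\<in>UNIV. \<Sum>j\<in>UNIV. G $ i $ j * R i j)
      - lam * Re (\<Sum>i\<in>UNIV. \<Sum>j\<in>UNIV. G $ i $ j * R0 i j)"
    using trace_herm_nonneg[OF w H(2)[OF V(2)], of x] by simp
  finally show ?thesis unfolding R_def R0_def by linarith
qed

lemma herm_matrix_sum:
  "herm (\<chi> \<alpha> \<beta>. \<Sum>i\<in>I. c i * M i $ \<alpha> $ \<beta>) s t = (\<Sum>i\<in>I. c i * herm (M i) s t)"
proof -
  have "herm (\<chi> \<alpha> \<beta>. \<Sum>i\<in>I. c i * M i $ \<alpha> $ \<beta>) s t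
      = (\<Sum>\<alpha>\<in>UNIV. \<Sum>\<beta>\<in>UNIV. \<Sum>i\<in>I. c i * (M i $ \<alpha> $ \<beta> * s $ \<alpha> * cnj (t $ \<beta>)))"
    by (simp add: herm_def sum_distrib_left sum_distrib_right mult_ac)
  also have "\<dots> = (\<Sum>\<alpha>\<in>UNIV. \<Sum>i\<in>I. \<Sum>\<beta>\<in>UNIV. c i * (M i $ \<alpha> $ \<beta> * s $ \<alpha> * cnj (t $ \<beta>)))"
    by (intro sum.cong refl sum.swap)
  also have "\<dots> = (\<Sum>i\<in>I. \<Sum>\<alpha>\<in>UNIV. \<Sum>\<beta>\<in>UNIV. c i * (M i $ \<alpha> $ \<beta> * s $ \<alpha> * cnj (t $ \<beta>)))"
    by (rule sum.swap)
  finally show ?thesis by (simp add: herm_def sum_distrib_left)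
qed

lemma herm_hym_matrix:
  "herm (hym_matrix g E \<pi> h c t x) s s = (\<Sum>i\<in>UNIV. \<Sum>j\<in>UNIV. transpose (matrix_inv (g c x)) $ i $ j *
     herm (lowered_curvature (snd c ` (fst c \<inter> fst t)) (\<lambda>z. gram E \<pi> t h (chart_inv c z))
          i j (snd c x)) s s)"
proof -
  let ?L = "\<lambda>i j. lowered_curvature (snd c ` (fst c \<inter> fst t)) (\<lambda>z. gram E \<pi> t h (chart_inv c z)) i j (snd c x)"
  let ?G = "transpose (matrix_inv (g c x))"
  have "hym_matrix g E \<pi> h c t x
      = (\<chi> \<alpha> \<beta>. \<Sum>i\<in>UNIV. 1 * (\<chi> \<alpha> \<beta>. \<Sum>j\<in>UNIV. ?G $ i $ j * ?L i j $ \<alpha> $ \<beta>) $ \<alpha> $ \<beta>)"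
    by (simp add: hym_matrix_def transpose_def)
  then have "herm (hym_matrix g E \<pi> h c t x) s s
      = (\<Sum>i\<in>UNIV. 1 * herm (\<chi> \<alpha> \<beta>. \<Sum>j\<in>UNIV. ?G $ i $ j * ?L i j $ \<alpha> $ \<beta>) s s)"
    by (simp only: herm_matrix_sum)
  then show ?thesis
    by (simp only: herm_matrix_sum mult_1)
qed

section \<open>Ratios of Hermitian forms\<close>

lemma usc_attains_sup:
  fixes u :: "'m \<Rightarrow> real"
  assumes X: "compact_space X" "topspace X \<noteq> {}"
    and u: "\<And>m. openin X {x \<in> topspace X. u x < m}"
  shows "\<exists>x0\<in>topspace X. \<forall>x\<in>topspace X. u x \<le> u x0"
proof (rule ccontr)
  assume "\<not> ?thesis"
  then have ex: "\<forall>x\<in>topspace X. \<exists>y\<in>topspace X. u x < u y"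
    by (simp add: not_le)
  define S where "S y = {x \<in> topspace X. u x < u y}" for y
  have op: "\<forall>U\<in>S ` topspace X. openin X U"
    unfolding S_def using u by blast
  have cov: "topspace X \<subseteq> \<Union>(S ` topspace X)"
    unfolding S_def using ex by blast
  obtain F where "finite F" "F \<subseteq> S ` topspace X" "topspace X \<subseteq> \<Union>F"
    using X(1)[unfolded compact_space_alt, THEN spec, of "S ` topspace X"] op cov by blast
  then obtain Y where Y: "finite Y" "topspace X \<subseteq> \<Union>(S ` Y)" "Y \<subseteq> topspace X"
    using finite_subset_image by metis
  then have "Y \<noteq> {}" using X(2) by blast
  then have "Max (u ` Y) \<in> u ` Y"
    using Y(1) by (intro Max_in) auto
  then obtain y where y: "y \<in> Y" "u y = Max (u ` Y)" by auto
  then obtain y' where y': "y' \<in> Y" "u y < u y'"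
    using Y(2,3) unfolding S_def by blast
  then have "u y' \<le> u y"
    unfolding y(2) using Y(1) by (intro Max_ge) auto
  with y'(2) show False by simp
qed

lemma herm_scaleR:
  "Re (herm H (c *\<^sub>R s) (c *\<^sub>R s)) = c\<^sup>2 * Re (herm H s s)"
proof -
  have "herm H (c *\<^sub>R s) (c *\<^sub>R s) = of_real (c\<^sup>2) * herm H s s"
    by (simp add: herm_def sum_distrib_left power2_eq_square scaleR_conv_of_real[where 'a = complex] mult_ac)
  then show ?thesis by simp
qed

lemma continuous_on_herm_diag: "continuous_on S (\<lambda>s. herm H s s)"
  unfolding herm_def by (intro continuous_intros)

lemma sphere_vec_nonempty: "sphere (0 :: complex^'r::finite) 1 \<noteq> {}"
proof -
  have "norm (axis undefined 1 :: complex^'r) = 1" by (simp add: norm_axis_1)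
  then show ?thesis by (metis empty_iff mem_sphere_0)
qed

lemma herm_diag_normalize:
  assumes "s \<noteq> 0"
  obtains e where "e \<in> sphere 0 1" "\<And>H. Re (herm H s s) = (norm s)\<^sup>2 * Re (herm H e e)"
proof
  show "(1 / norm s) *\<^sub>R s \<in> sphere 0 1" using assms by simp
  show "Re (herm H s s) = (norm s)\<^sup>2 * Re (herm H ((1 / norm s) *\<^sub>R s) ((1 / norm s) *\<^sub>R s))" for H
    using assms unfolding herm_scaleR by (simp add: power_divide)
qed

lemma herm_ratio_attains_max:
  assumes H0: "hermitian_pos_def H0"
  shows "\<exists>lam a. a \<noteq> 0 \<and> Re (herm H a a) = lam * Re (herm H0 a a) \<and>
    (\<forall>s. Re (herm H s s) \<le> lam * Re (herm H0 s s))"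
proof -
  let ?q = "\<lambda>s. Re (herm H s s) / Re (herm H0 s s)"
  have pos: "0 < Re (herm H0 s s)" if "s \<noteq> 0" for s
    using H0 that unfolding hermitian_pos_def_def by blast
  have "continuous_on (sphere 0 1) ?q"
    by (intro continuous_intros continuous_on_herm_diag ballI less_imp_neq[OF pos, symmetric]) auto
  then obtain a where a: "a \<in> sphere 0 1" "\<And>e. e \<in> sphere 0 1 \<Longrightarrow> ?q e \<le> ?q a"
    using continuous_attains_sup[OF compact_sphere sphere_vec_nonempty] by blast
  show ?thesis
  proof (intro exI conjI allI)
    show a0: "a \<noteq> 0" using a(1) by auto
    show "Re (herm H a a) = ?q a * Re (herm H0 a a)"
      using pos[OF a0] by simp
    show "Re (herm H s s) \<le> ?q a * Re (herm H0 s s)" for s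
    proof (cases "s = 0")
      case False
      then obtain e where e: "e \<in> sphere 0 1" "\<And>H. Re (herm H s s) = (norm s)\<^sup>2 * Re (herm H e e)"
        using herm_diag_normalize by blast
      then have "e \<noteq> 0" by auto
      then have "Re (herm H e e) \<le> ?q a * Re (herm H0 e e)"
        using a(2)[OF e(1)] pos_divide_le_eq[OF pos] by blast
      then have "(norm s)\<^sup>2 * Re (herm H e e) \<le> (norm s)\<^sup>2 * (?q a * Re (herm H0 e e))"
        by (intro mult_left_mono) auto
      then show ?thesis unfolding e(2) by (simp only: mult_ac)
    qed (simp add: herm_def)
  qed
qed

lemma Re_herm_diag_lower_bound:
  assumes "s \<in> sphere 0 1"
  shows "- (\<Sum>\<alpha>\<in>UNIV. \<Sum>\<beta>\<in>UNIV. cmod (M $ \<alpha> $ \<beta>)) \<le> Re (herm M s s)"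
proof -
  have "cmod (herm M s s) \<le> (\<Sum>\<alpha>\<in>UNIV. \<Sum>\<beta>\<in>UNIV. cmod (M $ \<alpha> $ \<beta>))"
    unfolding herm_def
  proof (intro sum_norm_le)
    fix \<alpha> \<beta>
    have "cmod (s $ \<alpha>) \<le> 1" "cmod (s $ \<beta>) \<le> 1"
      using Finite_Cartesian_Product.norm_nth_le[of s] assms by (metis mem_sphere_0)+
    then have "cmod (s $ \<alpha>) * cmod (s $ \<beta>) \<le> 1"
      by (intro mult_le_one) auto
    then show "cmod (M $ \<alpha> $ \<beta> * s $ \<alpha> * cnj (s $ \<beta>)) \<le> cmod (M $ \<alpha> $ \<beta>)"
      by (simp add: norm_mult mult.assoc mult_left_le)
  qed
  then show ?thesis
    using abs_Re_le_cmod[of "herm M s s"] by linarith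
qed

text \<open>Homogeneity reduces positivity to the unit sphere, where the form at \<open>z0\<close> is bounded below by some
  \<open>\<epsilon> > 0\<close>, and \<open>N z\<close> bounds the change of the form on the sphere.\<close>

lemma open_positive_definite:
  fixes K :: "'a::real_normed_vector \<Rightarrow> complex^'r::finite^'r"
  assumes V: "open V" and K: "\<And>\<alpha> \<beta>. continuous_on V (\<lambda>z. K z $ \<alpha> $ \<beta>)"
  shows "open {z \<in> V. \<forall>s. s \<noteq> 0 \<longrightarrow> 0 < Re (herm (K z) s s)}" (is "open ?O")
proof (subst open_subopen, intro ballI)
  fix z0 assume z0: "z0 \<in> ?O"
  obtain e where e: "e \<in> sphere 0 1"
    "\<And>s. s \<in> sphere 0 1 \<Longrightarrow> Re (herm (K z0) e e) \<le> Re (herm (K z0) s s)"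
    using continuous_attains_inf[OF compact_sphere sphere_vec_nonempty
        continuous_on_Re[OF continuous_on_herm_diag]] by blast
  define \<epsilon> where "\<epsilon> = Re (herm (K z0) e e)"
  have "e \<noteq> 0" using e(1) by auto
  then have "\<epsilon> > 0" using z0 by (simp add: \<epsilon>_def)
  define N where "N z = (\<Sum>\<alpha>\<in>UNIV. \<Sum>\<beta>\<in>UNIV. cmod ((K z - K z0) $ \<alpha> $ \<beta>))" for z
  have "continuous_on V N"
    unfolding N_def vector_minus_component by (intro continuous_intros K)
  then have "open (V \<inter> N -` {..<\<epsilon>})"
    using V by (simp add: continuous_on_open_vimage Int_commute)
  moreover have "z0 \<in> V \<inter> N -` {..<\<epsilon>}"
    using z0 \<open>\<epsilon> > 0\<close> by (simp add: N_def)
  moreover have "V \<inter> N -` {..<\<epsilon>} \<subseteq> ?O"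
  proof safe
    fix z s assume z: "z \<in> V" "N z < \<epsilon>" and "(s :: complex^'r) \<noteq> 0"
    then obtain f where f: "f \<in> sphere 0 1" "\<And>H. Re (herm H s s) = (norm s)\<^sup>2 * Re (herm H f f)"
      using herm_diag_normalize by blast
    have "herm (K z) f f = herm (K z0) f f + herm (K z - K z0) f f"
      by (simp add: herm_def algebra_simps sum_subtractf)
    then have "Re (herm (K z) f f) \<ge> \<epsilon> - N z"
      using e(2)[OF f(1)] Re_herm_diag_lower_bound[OF f(1), of "K z - K z0"]
      by (simp add: \<epsilon>_def N_def)
    then show "0 < Re (herm (K z) s s)"
      unfolding f(2) using z(2) \<open>s \<noteq> 0\<close> by simp
  qed
  ultimately show "\<exists>T. open T \<and> z0 \<in> T \<and> T \<subseteq> ?O" by blast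
qed

section \<open>Charts and trivializations\<close>

lemma chart_inv_left: "is_chart X c \<Longrightarrow> x \<in> fst c \<Longrightarrow> chart_inv c (snd c x) = x"
  unfolding is_chart_def chart_inv_def
  by (metis the_inv_into_f_f homeomorphic_imp_injective_map topspace_subtopology_subset openin_subset)

lemma open_chart_image:
  assumes "is_chart X c" "openin X U"
  shows "open (snd c ` (fst c \<inter> U))"
proof -
  have "openin (subtopology X (fst c)) (fst c \<inter> U)"
    using assms(2) by (rule openin_subtopology_Int2)
  then have "openin (top_of_set (snd c ` fst c)) (snd c ` (fst c \<inter> U))"
    using assms(1) homeomorphic_imp_open_map unfolding is_chart_def open_map_def by blast
  then show ?thesis
    using assms(1) unfolding is_chart_def by (metis openin_open_eq)
qed

lemma openin_chart_vimage:
  assumes "is_chart X c" "open O'"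
  shows "openin X {x \<in> fst c. snd c x \<in> O'}"
proof -
  have c: "openin X (fst c)" "continuous_map (subtopology X (fst c)) (top_of_set (snd c ` fst c)) (snd c)"
    using assms(1) homeomorphic_imp_continuous_map unfolding is_chart_def by blast+
  then have "continuous_map (subtopology X (fst c)) euclidean (snd c)"
    by (simp add: continuous_map_in_subtopology)
  then have "openin (subtopology X (fst c)) {x \<in> topspace (subtopology X (fst c)). snd c x \<in> O'}"
    using assms(2) by (intro openin_continuous_map_preimage) auto
  moreover have "topspace (subtopology X (fst c)) = fst c"
    using openin_subset[OF c(1)] by (rule topspace_subtopology_subset)
  ultimately show ?thesis
    using c(1) openin_trans_full by metis
qed

lemma triv_fibre_surj:
  assumes "is_triv X E \<pi> t" "x \<in> fst t"
  obtains v where "v \<in> topspace E" "\<pi> v = x" "snd t v = a"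
proof -
  have "(\<lambda>e. (\<pi> e, snd t e)) ` topspace (subtopology E {e \<in> topspace E. \<pi> e \<in> fst t})
      = topspace (prod_topology (subtopology X (fst t)) (euclidean :: (complex^'c) topology))"
    using assms(1) homeomorphic_imp_surjective_map unfolding is_triv_def by blast
  moreover have "x \<in> topspace X"
    using assms openin_subset unfolding is_triv_def by blast
  ultimately have "(x, a) \<in> (\<lambda>e. (\<pi> e, snd t e)) ` topspace (subtopology E {e \<in> topspace E. \<pi> e \<in> fst t})"
    using assms(2) by simp
  then show ?thesis using that by auto
qed

lemma holomorphic_vector_bundle_proj:
  assumes "holomorphic_vector_bundle X A E \<pi> T" "v \<in> topspace E"
  shows "\<pi> v \<in> topspace X"
proof -
  have "continuous_map E X \<pi>"
    using assms(1) unfolding holomorphic_vector_bundle_def by (rule conjunct1)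
  from continuous_map_image_subset_topspace[OF this] assms(2) show ?thesis by blast
qed

lemma holomorphic_vector_bundle_triv:
  assumes "holomorphic_vector_bundle X A E \<pi> T" "x \<in> topspace X"
  shows "\<exists>t\<in>T. x \<in> fst t \<and> is_triv X E \<pi> t"
proof -
  have "topspace X = (\<Union>t\<in>T. fst t)" "\<forall>t\<in>T. is_triv X E \<pi> t"
    using assms(1) unfolding holomorphic_vector_bundle_def by simp_all
  with assms(2) show ?thesis by blast
qed

section \<open>The maximal ratio on a compact base\<close>

lemma bundle_metric_diag:
  assumes "bundle_metric A E \<pi> T h" "t \<in> T" "v \<in> topspace E" "\<pi> v \<in> fst t"
  shows "h v v = herm (gram E \<pi> t h (\<pi> v)) (snd t v) (snd t v)"
  using assms unfolding bundle_metric_def by blast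

lemma bundle_metric_gram_pos:
  assumes "bundle_metric A E \<pi> T h" "t \<in> T" "x \<in> fst t"
  shows "hermitian_pos_def (gram E \<pi> t h x)"
  using assms unfolding bundle_metric_def by blast

lemma bundle_metric_gram_smooth:
  assumes "bundle_metric A E \<pi> T h" "t \<in> T" "c \<in> A"
  shows "smooth_on (\<lambda>z. gram E \<pi> t h (chart_inv c z) $ \<alpha> $ \<beta>) (snd c ` (fst c \<inter> fst t))"
  using assms unfolding bundle_metric_def by blast

lemma bundle_metric_pos_iff:
  assumes "bundle_metric A E \<pi> T h" "t \<in> T" "v \<in> topspace E" "\<pi> v \<in> fst t"
  shows "0 < Re (h v v) \<longleftrightarrow> snd t v \<noteq> 0"
proof (cases "snd t v = 0")
  case True
  then show ?thesis unfolding bundle_metric_diag[OF assms] by (simp add: herm_def)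
next
  case False
  then have "0 < Re (h v v)"
    using bundle_metric_gram_pos[OF assms(1,2,4)]
    unfolding bundle_metric_diag[OF assms] hermitian_pos_def_def by blast
  with False show ?thesis by simp
qed

lemma bundle_metric_nonneg:
  assumes "bundle_metric A E \<pi> T h" "t \<in> T" "v \<in> topspace E" "\<pi> v \<in> fst t"
  shows "0 \<le> Re (h v v)"
  using hermitian_pos_def_herm_nonneg[OF bundle_metric_gram_pos[OF assms(1,2,4)]]
  unfolding bundle_metric_diag[OF assms] .

text \<open>\<open>lam\<close> is the maximum of \<open>h(v, v) / h0(v, v)\<close> over the nonzero vectors \<open>v\<close> of the fibre over \<open>x\<close>.  The
  condition \<open>0 < Re (h0 v v)\<close> says that the vector at which it is attained is not zero, without mention of a
  trivialization.\<close>

definition is_fibre_max_ratio ::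
  "'e topology \<Rightarrow> ('e \<Rightarrow> 'm) \<Rightarrow> ('e \<Rightarrow> 'e \<Rightarrow> complex) \<Rightarrow> ('e \<Rightarrow> 'e \<Rightarrow> complex) \<Rightarrow> 'm \<Rightarrow> real \<Rightarrow> bool" where
  "is_fibre_max_ratio E \<pi> h h0 x lam \<longleftrightarrow>
     (\<forall>v\<in>topspace E. \<pi> v = x \<longrightarrow> Re (h v v) \<le> lam * Re (h0 v v)) \<and>
     (\<exists>v\<in>topspace E. \<pi> v = x \<and> 0 < Re (h0 v v) \<and> Re (h v v) = lam * Re (h0 v v))"

lemma fibre_max_ratio_exists:
  assumes "is_triv X E \<pi> t" "t \<in> T" "x \<in> fst t"
    and h: "bundle_metric A E \<pi> T h" and h0: "bundle_metric A E \<pi> T h0"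
  shows "\<exists>lam. is_fibre_max_ratio E \<pi> h h0 x lam"
proof -
  obtain a and lam :: real where a: "a \<noteq> 0"
    "Re (herm (gram E \<pi> t h x) a a) = lam * Re (herm (gram E \<pi> t h0 x) a a)"
    "\<And>s. Re (herm (gram E \<pi> t h x) s s) \<le> lam * Re (herm (gram E \<pi> t h0 x) s s)"
    using herm_ratio_attains_max[OF bundle_metric_gram_pos[OF h0 assms(2,3)], of "gram E \<pi> t h x"] by blast
  obtain v where v: "v \<in> topspace E" "\<pi> v = x" "snd t v = a"
    using triv_fibre_surj[OF assms(1,3)] .
  have "Re (h w w) \<le> lam * Re (h0 w w)" if "w \<in> topspace E" "\<pi> w = x" for w
    using a(3) that assms(3)
    by (simp add: bundle_metric_diag[OF h assms(2)] bundle_metric_diag[OF h0 assms(2)])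
  moreover have "0 < Re (h0 v v)"
    using bundle_metric_pos_iff[OF h0 assms(2) v(1)] v assms(3) a(1) by simp
  moreover have "Re (h v v) = lam * Re (h0 v v)"
    using a(2) v assms(3)
    by (simp add: bundle_metric_diag[OF h assms(2)] bundle_metric_diag[OF h0 assms(2)])
  ultimately show ?thesis using v unfolding is_fibre_max_ratio_def by blast
qed

lemma fibre_max_ratio_less_iff:
  fixes t :: "('m, 'e, 'r::finite) triv"
  assumes "is_triv X E \<pi> t" "t \<in> T" "x \<in> fst t"
    and h: "bundle_metric A E \<pi> T h" and h0: "bundle_metric A E \<pi> T h0"
    and lam: "is_fibre_max_ratio E \<pi> h h0 x lam"
  shows "lam < m \<longleftrightarrow> (\<forall>s. s \<noteq> 0 \<longrightarrow>
    0 < Re (herm (\<chi> \<alpha> \<beta>. of_real m * gram E \<pi> t h0 x $ \<alpha> $ \<beta> - gram E \<pi> t h x $ \<alpha> $ \<beta>) s s))"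
    (is "_ \<longleftrightarrow> (\<forall>s. s \<noteq> 0 \<longrightarrow> 0 < Re (herm ?K s s))")
proof -
  have K: "Re (herm ?K (snd t v) (snd t v)) = m * Re (h0 v v) - Re (h v v)"
    if "v \<in> topspace E" "\<pi> v = x" for v
  proof -
    have "herm ?K s s = of_real m * herm (gram E \<pi> t h0 x) s s - herm (gram E \<pi> t h x) s s" for s
      by (simp add: herm_def algebra_simps sum_subtractf sum_distrib_left)
    then show ?thesis
      using that assms(3) bundle_metric_diag[OF h assms(2)] bundle_metric_diag[OF h0 assms(2)] by simp
  qed
  show ?thesis
  proof safe
    fix s :: "complex^'r" assume "lam < m" and s: "s \<noteq> 0"
    obtain v where v: "v \<in> topspace E" "\<pi> v = x" "snd t v = s"
      using triv_fibre_surj[OF assms(1,3)] .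
    have "0 < Re (h0 v v)"
      using bundle_metric_pos_iff[OF h0 assms(2) v(1)] v assms(3) s by simp
    then have "lam * Re (h0 v v) < m * Re (h0 v v)"
      using \<open>lam < m\<close> by simp
    moreover have "Re (h v v) \<le> lam * Re (h0 v v)"
      using lam v unfolding is_fibre_max_ratio_def by blast
    ultimately show "0 < Re (herm ?K s s)"
      using K[OF v(1,2)] v(3) by simp
  next
    assume K_pos: "\<forall>s. s \<noteq> 0 \<longrightarrow> 0 < Re (herm ?K s s)"
    obtain v where v: "v \<in> topspace E" "\<pi> v = x" "0 < Re (h0 v v)" "Re (h v v) = lam * Re (h0 v v)"
      using lam unfolding is_fibre_max_ratio_def by blast
    then have "snd t v \<noteq> 0"
      using bundle_metric_pos_iff[OF h0 assms(2) v(1)] assms(3) by simp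
    then have "0 < m * Re (h0 v v) - Re (h v v)"
      unfolding K[OF v(1,2), symmetric] using K_pos by blast
    then show "lam < m" using v by simp
  qed
qed

text \<open>The fibrewise maximal ratio is upper semicontinuous.\<close>

lemma openin_fibre_max_ratio_less:
  assumes M: "compact_complex_manifold X A" and B: "holomorphic_vector_bundle X A E \<pi> T"
    and h: "bundle_metric A E \<pi> T h" and h0: "bundle_metric A E \<pi> T h0"
    and u: "\<And>x. x \<in> topspace X \<Longrightarrow> is_fibre_max_ratio E \<pi> h h0 x (u x)"
  shows "openin X {x \<in> topspace X. u x < m}"
proof (subst openin_subopen, intro ballI)
  fix x assume x: "x \<in> {x \<in> topspace X. u x < m}"
  obtain c where c: "c \<in> A" "x \<in> fst c" "is_chart X c"
    using x M unfolding compact_complex_manifold_def by blast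
  obtain t where t: "t \<in> T" "x \<in> fst t" "is_triv X E \<pi> t"
    using holomorphic_vector_bundle_triv[OF B] x by blast
  have tX: "openin X (fst t)" using t(3) unfolding is_triv_def by blast
  define K where "K y = (\<chi> \<alpha> \<beta>. of_real m * gram E \<pi> t h0 y $ \<alpha> $ \<beta> - gram E \<pi> t h y $ \<alpha> $ \<beta>)" for y
  define V where "V = snd c ` (fst c \<inter> fst t)"
  define W where "W = {z \<in> V. \<forall>s. s \<noteq> 0 \<longrightarrow> 0 < Re (herm (K (chart_inv c z)) s s)}"
  have V: "open V" unfolding V_def using c(3) tX by (rule open_chart_image)
  have cont: "continuous_on V (\<lambda>z. gram E \<pi> t k (chart_inv c z) $ \<alpha> $ \<beta>)"
    if "bundle_metric A E \<pi> T k" for k \<alpha> \<beta>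
    using bundle_metric_gram_smooth[OF that t(1) c(1)] unfolding V_def
    by (rule smooth_on_imp_continuous_on)
  have "open W"
    unfolding W_def
    by (rule open_positive_definite[OF V]) (simp add: K_def, intro continuous_intros cont h h0)
  have iff: "y \<in> topspace X \<and> u y < m \<longleftrightarrow> snd c y \<in> W" if "y \<in> fst c" "y \<in> fst t" for y
  proof -
    have "y \<in> topspace X" using tX that openin_subset by blast
    then show ?thesis
      using fibre_max_ratio_less_iff[OF t(3,1) that(2) h h0 u] that
      by (auto simp: W_def V_def K_def chart_inv_left[OF c(3)])
  qed
  have "openin X ({y \<in> fst c. snd c y \<in> W} \<inter> fst t)"
    using openin_chart_vimage[OF c(3) \<open>open W\<close>] tX by (rule openin_Int)
  then show "\<exists>U. openin X U \<and> x \<in> U \<and> U \<subseteq> {x \<in> topspace X. u x < m}"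
    using iff c(2) t(2) x by (intro exI[of _ "{y \<in> fst c. snd c y \<in> W} \<inter> fst t"]) blast
qed

lemma max_ratio_attained:
  assumes M: "compact_complex_manifold X A" and B: "holomorphic_vector_bundle X A E \<pi> T"
    and h: "bundle_metric A E \<pi> T h" and h0: "bundle_metric A E \<pi> T h0"
    and ne: "topspace E \<noteq> {}"
  shows "\<exists>lam. \<exists>v\<in>topspace E. 0 < Re (h0 v v) \<and> Re (h v v) = lam * Re (h0 v v) \<and>
    (\<forall>w\<in>topspace E. Re (h w w) \<le> lam * Re (h0 w w))"
proof -
  note \<pi> = holomorphic_vector_bundle_proj[OF B]
  note T = holomorphic_vector_bundle_triv[OF B]
  have ex: "\<exists>lam. is_fibre_max_ratio E \<pi> h h0 x lam" if x: "x \<in> topspace X" for x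
  proof -
    obtain t where t: "is_triv X E \<pi> t" "t \<in> T" "x \<in> fst t" using T[OF x] by blast
    show ?thesis by (rule fibre_max_ratio_exists[OF t h h0])
  qed
  define u where "u x = (SOME lam. is_fibre_max_ratio E \<pi> h h0 x lam)" for x
  have u: "is_fibre_max_ratio E \<pi> h h0 x (u x)" if "x \<in> topspace X" for x
    unfolding u_def using ex[OF that] by (rule someI_ex)
  have X: "compact_space X"
    using M by (simp add: compact_complex_manifold_def)
  have X_ne: "topspace X \<noteq> {}"
    using \<pi> ne by blast
  have "\<exists>x0\<in>topspace X. \<forall>x\<in>topspace X. u x \<le> u x0"
    by (rule usc_attains_sup[OF X X_ne openin_fibre_max_ratio_less[OF M B h h0 u]])
  then obtain x0 where x0: "x0 \<in> topspace X" "\<And>x. x \<in> topspace X \<Longrightarrow> u x \<le> u x0"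
    by blast
  obtain v where v: "v \<in> topspace E" "0 < Re (h0 v v)" "Re (h v v) = u x0 * Re (h0 v v)"
    using u[OF x0(1)] unfolding is_fibre_max_ratio_def by blast
  have "Re (h w w) \<le> u x0 * Re (h0 w w)" if w: "w \<in> topspace E" for w
  proof -
    obtain t where "t \<in> T" "\<pi> w \<in> fst t" using T[OF \<pi>[OF w]] by blast
    then have "0 \<le> Re (h0 w w)" using bundle_metric_nonneg[OF h0 _ w] by blast
    then have "u (\<pi> w) * Re (h0 w w) \<le> u x0 * Re (h0 w w)"
      using x0(2)[OF \<pi>[OF w]] by (simp add: mult_right_mono)
    moreover have "Re (h w w) \<le> u (\<pi> w) * Re (h0 w w)"
      using u[OF \<pi>[OF w]] w unfolding is_fibre_max_ratio_def by blast
    ultimately show ?thesis by simp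
  qed
  with v show ?thesis by (intro exI[of _ "u x0"] bexI[of _ v]) simp_all
qed

section \<open>The comparison theorem\<close>

text \<open>The local comparison is applied in the very chart and trivialization that the definition of
  \<open>hym_tensor\<close> selects at \<open>\<pi> v\<close>, so the transformation behaviour of its components plays no role.\<close>

lemma hym_tensor_comparison_at_max:
  fixes X :: "'m topology" and A :: "('m, 'n::finite) chart set" and lam :: real
  assumes M: "compact_complex_manifold X A" and g: "hermitian_metric A g"
    and B: "holomorphic_vector_bundle X A E \<pi> T"
    and h: "bundle_metric A E \<pi> T h" and h0: "bundle_metric A E \<pi> T h0"
    and v: "v \<in> topspace E" "Re (h v v) = lam * Re (h0 v v)"
    and le: "\<And>w. w \<in> topspace E \<Longrightarrow> Re (h w w) \<le> lam * Re (h0 w w)"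
  shows "lam * Re (hym_tensor A g E \<pi> T h0 v v) \<le> Re (hym_tensor A g E \<pi> T h v v)"
proof -
  define x0 where "x0 = \<pi> v"
  define c where "c = (SOME c. c \<in> A \<and> x0 \<in> fst c)"
  define t where "t = (SOME t. t \<in> T \<and> x0 \<in> fst t)"
  have x0: "x0 \<in> topspace X"
    unfolding x0_def using holomorphic_vector_bundle_proj[OF B v(1)] .
  have "\<exists>c. c \<in> A \<and> x0 \<in> fst c"
    using x0 M unfolding compact_complex_manifold_def by blast
  then have c: "c \<in> A" "x0 \<in> fst c"
    unfolding c_def using someI_ex[of "\<lambda>c. c \<in> A \<and> x0 \<in> fst c"] by blast+
  have "\<exists>t. t \<in> T \<and> x0 \<in> fst t"
    using holomorphic_vector_bundle_triv[OF B x0] by blast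
  then have t: "t \<in> T" "x0 \<in> fst t"
    unfolding t_def using someI_ex[of "\<lambda>t. t \<in> T \<and> x0 \<in> fst t"] by blast+
  have cX: "is_chart X c" using M c(1) unfolding compact_complex_manifold_def by blast
  have tX: "is_triv X E \<pi> t" using B t(1) unfolding holomorphic_vector_bundle_def by simp
  define V where "V = snd c ` (fst c \<inter> fst t)"
  define z0 where "z0 = snd c x0"
  have V: "open V"
    unfolding V_def using tX by (intro open_chart_image[OF cX]) (simp add: is_triv_def)
  have z0: "z0 \<in> V" using c t by (simp add: V_def z0_def)
  have inv: "chart_inv c z \<in> fst t" if "z \<in> V" for z
    using that by (auto simp: V_def chart_inv_left[OF cX])
  have inv0: "chart_inv c z0 = x0"
    unfolding z0_def using cX c(2) by (rule chart_inv_left)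
  have tensor: "hym_tensor A g E \<pi> T k v v = (\<Sum>i\<in>UNIV. \<Sum>j\<in>UNIV. transpose (matrix_inv (g c x0)) $ i $ j *
     herm (lowered_curvature V (\<lambda>z. gram E \<pi> t k (chart_inv c z)) i j z0) (snd t v) (snd t v))" for k
    unfolding hym_tensor_def Let_def x0_def[symmetric] c_def[symmetric] t_def[symmetric]
      herm_hym_matrix V_def z0_def ..
  have gpos: "hermitian_pos_def (g c x0)"
    using g c unfolding hermitian_metric_def by blast
  show ?thesis
    unfolding tensor
  proof (rule curvature_comparison_at_min[OF V z0])
    fix z s assume z: "z \<in> V"
    obtain w where w: "w \<in> topspace E" "\<pi> w = chart_inv c z" "snd t w = s"
      using triv_fibre_surj[OF tX inv[OF z]] .
    show "Re (herm (gram E \<pi> t h (chart_inv c z)) s s) \<le> lam * Re (herm (gram E \<pi> t h0 (chart_inv c z)) s s)"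
      using le[OF w(1)] inv[OF z] w
      by (simp add: bundle_metric_diag[OF h t(1)] bundle_metric_diag[OF h0 t(1)])
  next
    show "Re (herm (gram E \<pi> t h (chart_inv c z0)) (snd t v) (snd t v))
        = lam * Re (herm (gram E \<pi> t h0 (chart_inv c z0)) (snd t v) (snd t v))"
      unfolding inv0 using v t(2)
      by (simp add: x0_def bundle_metric_diag[OF h t(1)] bundle_metric_diag[OF h0 t(1)])
  next
    show "smooth_on (\<lambda>z. gram E \<pi> t h (chart_inv c z) $ \<alpha> $ \<beta>) V"
      "smooth_on (\<lambda>z. gram E \<pi> t h0 (chart_inv c z) $ \<alpha> $ \<beta>) V" for \<alpha> \<beta>
      unfolding V_def
      by (rule bundle_metric_gram_smooth[OF h t(1) c(1)], rule bundle_metric_gram_smooth[OF h0 t(1) c(1)])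
    show "hermitian_pos_def (gram E \<pi> t h (chart_inv c z))"
      "hermitian_pos_def (gram E \<pi> t h0 (chart_inv c z))" if "z \<in> V" for z
      using bundle_metric_gram_pos[OF h t(1) inv[OF that]] bundle_metric_gram_pos[OF h0 t(1) inv[OF that]] .
    show "transpose (matrix_inv (g c x0)) $ j $ i = cnj (transpose (matrix_inv (g c x0)) $ i $ j)" for i j
      by (rule inverse_metric_psd(1)[OF gpos])
    show "0 \<le> Re (herm (transpose (matrix_inv (g c x0))) s s)" for s
      by (rule inverse_metric_psd(2)[OF gpos])
  qed
qed

theorem corollary1p4:
  fixes X :: "'m topology" and A :: "('m, 'n::finite) chart set"
    and g :: "('m, 'n) chart \<Rightarrow> 'm \<Rightarrow> complex^'n^'n"
    and E :: "'e topology" and \<pi> :: "'e \<Rightarrow> 'm" and T :: "('m, 'e, 'r::finite) triv set"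
    and h h0 :: "'e \<Rightarrow> 'e \<Rightarrow> complex"
  assumes "compact_complex_manifold X A"
    and "hermitian_metric A g"
    and "holomorphic_vector_bundle X A E \<pi> T"
    and "bundle_metric A E \<pi> T h"
    and "bundle_metric A E \<pi> T h0"
    and "form_pos E \<pi> T (hym_tensor A g E \<pi> T h0)"
    and "form_le E (hym_tensor A g E \<pi> T h) (hym_tensor A g E \<pi> T h0)"
  shows "form_le E h h0"
proof (cases "topspace E = {}")
  case True
  then show ?thesis by (simp add: form_le_def)
next
  case False
  have triv: "\<exists>t\<in>T. \<pi> v \<in> fst t" if "v \<in> topspace E" for v
    using holomorphic_vector_bundle_triv[OF assms(3) holomorphic_vector_bundle_proj[OF assms(3) that]] by blast
  obtain v and lam :: real where v: "v \<in> topspace E" "0 < Re (h0 v v)" "Re (h v v) = lam * Re (h0 v v)"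
    and le: "\<And>w. w \<in> topspace E \<Longrightarrow> Re (h w w) \<le> lam * Re (h0 w w)"
    using max_ratio_attained[OF assms(1,3,4,5) False] by blast
  let ?S = "\<lambda>k. Re (hym_tensor A g E \<pi> T k v v)"
  have "lam * ?S h0 \<le> ?S h"
    using assms(1-5) v(1,3) le by (rule hym_tensor_comparison_at_max)
  also have "\<dots> \<le> ?S h0"
    using assms(7) v(1) unfolding form_le_def by blast
  finally have "lam * ?S h0 \<le> 1 * ?S h0" by simp
  moreover obtain t where t: "t \<in> T" "\<pi> v \<in> fst t" using triv[OF v(1)] by blast
  then have "snd t v \<noteq> 0"
    using bundle_metric_pos_iff[OF assms(5) t(1) v(1) t(2)] v(2) by simp
  then have "0 < ?S h0"
    using assms(6) v(1) t unfolding form_pos_def by blast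
  ultimately have "lam \<le> 1"
    by (simp only: mult_le_cancel_right_pos)
  show ?thesis
    unfolding form_le_def
  proof
    fix w assume w: "w \<in> topspace E"
    then obtain t where "t \<in> T" "\<pi> w \<in> fst t" using triv by blast
    then have "0 \<le> Re (h0 w w)" using bundle_metric_nonneg[OF assms(5) _ w] by blast
    then have "lam * Re (h0 w w) \<le> Re (h0 w w)"
      using \<open>lam \<le> 1\<close> mult_right_mono[of lam 1 "Re (h0 w w)"] by simp
    with le[OF w] show "Re (h w w) \<le> Re (h0 w w)" by simp
  qed
qed

end
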